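(* Let $R$ be a complete discrete valuation ring and let $\pi\in R$ be a generator of its maximal ideal. Let $f(X)\in R[X]$ be a monic polynomial of degree $M$ with $f(X)\equiv_\pi X^M$. Let $n\ge1$ and let $g_{(1)}(X),\dots,g_{(n)}(X)\in R[X]$ be monic polynomials of degrees $m_{(k)}:=\deg g_{(k)}\ge 1$, ordered such that $m_{(1)}\le m_{(2)}\le\dots\le m_{(n)}$, and such that $\mathrm{Res}(g_{(1)},\dots,g_{(n)})\ne0$. Write $$t:=\mathrm{v}_\pi\big(\mathrm{Res}(g_{(1)},\dots,g_{(n)})\big),\qquad t':=t-\sum_{j\in[1,n-1]}\big((n-j)m_{(j)}-1\big).$$ Let $s\ge1$ be an integer with $s\ge t+t'+1$ and suppose that $f(X)\equiv_{\pi^s}\prod_{k\in[1,n]}g_{(k)}(X)$. Then there exist unique monic polynomials $\check g_{(1)}(X),\dots,\check g_{(n)}(X)\in R[X]$ such that $$\check g_{(k)}(X)\equiv_{\pi^{s-t'}} g_{(k)}(X)\ \text{ for } k\in[1,n]\qquad\text{and}\qquad f(X)=\prod_{k\in[1,n]}\check g_{(k)}(X).$$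
   Context: Notation: $[a,b]=\{z\in\mathbb{Z}: a\le z\le b\}$. For $u\in R$ and $x,y$ in $R$ (resp. $R[X]$), $x\equiv_u y$ means $x-y\in uR$ (resp. $x-y\in uR[X]$). For $x\in R\setminus\{0\}$, $\mathrm{v}_\pi(x)=\max\{i\in\mathbb{Z}_{\ge0}:\pi^i\text{ divides }x\}$, and $\mathrm{v}_\pi(0)=+\infty$. Generalised Sylvester matrix and resultant: let $g_{(1)},\dots,g_{(n)}\in R[X]$ be monic of degrees $m_{(k)}:=\deg g_{(k)}\ge1$. Put $N:=\sum_{j\in[1,n]}m_{(j)}$, $N_{(k)}:=N-m_{(k)}$ and write $\prod_{j\in[1,n]\setminus\{k\}}g_{(j)}(X)=\sum_{i\in[0,N_{(k)}]}a_{(k)i}X^i$. Then $\mathrm{Sylv}(g_{(1)},\dots,g_{(n)})\in R^{N\times N}$ is the matrix consisting of $n$ consecutive blocks of rows, the $k$-th block having $m_{(k)}$ rows; for $p\in[1,m_{(k)}]$, the $p$-th row of the $k$-th block has entry $a_{(k)\,q-p}$ in column $q$ if $p\le q\le p+N_{(k)}$ and entry $0$ in all other columns $q\in[1,N]$. The resultant is $\mathrm{Res}(g_{(1)},\dots,g_{(n)}):=\det\mathrm{Sylv}(g_{(1)},\dots,g_{(n)})\in R$. (In the setting of the claim, $N=M$ and $g_{(k)}(X)\equiv_\pi X^{m_{(k)}}$ for all $k$.) *)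

theory Defs
  imports
    "HOL-Algebra.Algebraic_Closure_Type"
    "HOL-Library.Extended_Nat"
    "Jordan_Normal_Form.Determinant"
begin

text \<open>
  Ring-theoretic notions (ideals, principal ideal domains, fields) are those of
  \<^theory>\<open>HOL-Algebra.Ring_Divisibility\<close>, applied to the ring
  \<^const>\<open>ring_of_type_algebra\<close> carried by a type. A discrete valuation ring is a local
  principal ideal domain that is not a field.
\<close>

class discrete_valuation_ring = idom +
  assumes principal: "principal_domain (ring_of_type_algebra :: 'a ring)"
    and not_field: "\<not> field (ring_of_type_algebra :: 'a ring)"
    and local: "\<exists>!I. maximalideal I (ring_of_type_algebra :: 'a ring)"

definition (in comm_ring_1) uniformizer :: "'a \<Rightarrow> bool" where
  "uniformizer \<pi> \<longleftrightarrow>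
     maximalideal (PIdl\<^bsub>(ring_of_type_algebra :: 'a ring)\<^esub> \<pi>) (ring_of_type_algebra :: 'a ring)"

definition (in comm_ring_1) adic_Cauchy :: "'a \<Rightarrow> (nat \<Rightarrow> 'a) \<Rightarrow> bool" where
  "adic_Cauchy u x \<longleftrightarrow> (\<forall>i. \<exists>K. \<forall>m\<ge>K. \<forall>n\<ge>K. u ^ i dvd x m - x n)"

definition (in comm_ring_1) adic_LIMSEQ :: "'a \<Rightarrow> (nat \<Rightarrow> 'a) \<Rightarrow> 'a \<Rightarrow> bool" where
  "adic_LIMSEQ u x l \<longleftrightarrow> (\<forall>i. \<exists>K. \<forall>n\<ge>K. u ^ i dvd x n - l)"

class complete_discrete_valuation_ring = discrete_valuation_ring +
  assumes complete: "uniformizer \<pi> \<Longrightarrow> adic_Cauchy \<pi> x \<Longrightarrow> \<exists>l. adic_LIMSEQ \<pi> x l"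

text \<open>
  For a uniformizer of a discrete valuation ring and \<open>x \<noteq> 0\<close>, the set below is finite, so
  that its maximum is meaningful. The library's \<open>multiplicity\<close> needs a ring with a division
  operation and has value \<open>0\<close>, not \<open>\<infinity>\<close>, at \<open>0\<close>.
\<close>

definition valuation :: "'a::comm_ring_1 \<Rightarrow> 'a \<Rightarrow> enat" where
  "valuation \<pi> x = (if x = 0 then \<infinity> else enat (Max {i. \<pi> ^ i dvd x}))"

text \<open>Congruence modulo the ideal of \<open>R[X]\<close> that consists of the multiples of \<open>u \<in> R\<close>.\<close>

definition poly_cong :: "'a::comm_ring_1 \<Rightarrow> 'a poly \<Rightarrow> 'a poly \<Rightarrow> bool" where
  "poly_cong u p q \<longleftrightarrow> [:u:] dvd p - q"

text \<open>
  The generalised Sylvester matrix of \<open>g 1, \<dots>, g n\<close>. The blocks and factors are numbered from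
  \<open>1\<close>; the rows inside a block (\<open>p\<close>) and the columns (\<open>q\<close>) are numbered from \<open>0\<close>, which leaves
  the index \<open>q - p\<close> of the coefficient unchanged.
\<close>

definition sylv_cofactor :: "nat \<Rightarrow> (nat \<Rightarrow> 'a::comm_ring_1 poly) \<Rightarrow> nat \<Rightarrow> 'a poly" where
  "sylv_cofactor n g k = (\<Prod>j\<in>{1..n} - {k}. g j)"

definition sylv_size :: "nat \<Rightarrow> (nat \<Rightarrow> 'a::comm_ring_1 poly) \<Rightarrow> nat" where
  "sylv_size n g = (\<Sum>j\<in>{1..n}. degree (g j))"

definition sylv_row :: "nat \<Rightarrow> (nat \<Rightarrow> 'a::comm_ring_1 poly) \<Rightarrow> nat \<Rightarrow> nat \<Rightarrow> 'a vec" where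
  "sylv_row n g k p = vec (sylv_size n g)
     (\<lambda>q. if p \<le> q \<and> q \<le> p + (sylv_size n g - degree (g k))
          then coeff (sylv_cofactor n g k) (q - p) else 0)"

definition sylv :: "nat \<Rightarrow> (nat \<Rightarrow> 'a::comm_ring_1 poly) \<Rightarrow> 'a mat" where
  "sylv n g = mat_of_rows (sylv_size n g)
     (concat (map (\<lambda>k. map (sylv_row n g k) [0..<degree (g k)]) [1..<n + 1]))"

definition res :: "nat \<Rightarrow> (nat \<Rightarrow> 'a::comm_ring_1 poly) \<Rightarrow> 'a" where
  "res n g = det (sylv n g)"

end

theory Submission
  imports Defs
begin

text \<open>
  Let \<open>m j\<close> be the degree of \<open>g j\<close>. Modulo \<open>\<pi>\<close>, the factors \<open>g j\<close> are the monomials \<open>X ^ m j\<close>, so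
  column \<open>q\<close> of the Sylvester matrix is divisible by \<open>\<pi> ^ c q\<close>, where \<open>c q\<close> is the number of
  \<open>d < n\<close> with \<open>q < m 1 + \<dots> + m d\<close>. The minors that form the adjugate lose one column, and
  \<open>c q \<le> n - 1\<close>, so the adjugate is divisible by \<open>\<pi> ^ e\<close> with
  \<open>e = (\<Sum>q. c q) - (n - 1) = t - t'\<close>. Hence every multiple of \<open>\<pi> ^ t'\<close> of degree less than the
  size of the matrix is a combination \<open>\<Sum>k. u k * (\<Prod>j\<noteq>k. g j)\<close> with \<open>degree (u k) < m k\<close>, for a unique
  \<open>u\<close> because the resultant is nonzero.

  Write the unknown factors as \<open>g k + \<pi> ^ (s - t') * u k\<close> and expand their product into its constant,
  linear and higher parts. As \<open>s > 2 * t'\<close>, inverting the linear part turns the equation into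
  a fixed point equation \<open>u = \<Phi> u\<close> in which \<open>\<Phi>\<close> gains a factor \<open>\<pi>\<close> on differences. By completeness,
  this contraction has exactly one fixed point.
\<close>

unbundle no fps_syntax

section \<open>Discrete valuation rings\<close>

lemma ring_of_type_algebra_simps [simp]:
  "carrier ring_of_type_algebra = UNIV"
  "x \<otimes>\<^bsub>ring_of_type_algebra\<^esub> y = x * y"
  "x \<oplus>\<^bsub>ring_of_type_algebra\<^esub> y = x + y"
  "\<one>\<^bsub>ring_of_type_algebra\<^esub> = 1"
  "\<zero>\<^bsub>ring_of_type_algebra\<^esub> = 0"
  by (simp_all add: ring_of_type_algebra_def)

lemma cgenideal_type_algebra:
  "PIdl\<^bsub>(ring_of_type_algebra :: 'a::comm_ring_1 ring)\<^esub> a = {x. a dvd x}"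
  by (auto simp: cgenideal_def dvd_def mult.commute)

lemma Units_type_algebra:
  "Units (ring_of_type_algebra :: 'a::comm_ring_1 ring) = {x. x dvd 1}"
  by (auto simp: Units_def dvd_def mult.commute)

text \<open>If \<open>\<pi>\<close> were \<open>0\<close>, the zero ideal would be maximal, and a
  commutative ring with that property is a field.\<close>

lemma uniformizer_nonzero:
  fixes \<pi> :: "'a::discrete_valuation_ring"
  assumes "uniformizer \<pi>"
  shows "\<pi> \<noteq> 0"
proof
  assume "\<pi> = 0"
  interpret cring "ring_of_type_algebra :: 'a ring"
    by (rule cring_from_type_algebra)
  have "maximalideal {\<zero>\<^bsub>ring_of_type_algebra\<^esub>} (ring_of_type_algebra :: 'a ring)"
    using assms \<open>\<pi> = 0\<close> by (simp add: uniformizer_def cgenideal_type_algebra)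
  then show False
    using zeromaximalideal_fieldI not_field by blast
qed

lemma uniformizer_imp_prime_elem:
  fixes \<pi> :: "'a::discrete_valuation_ring"
  assumes "uniformizer \<pi>"
  shows "prime_elem \<pi>"
proof -
  interpret cring "ring_of_type_algebra :: 'a ring"
    by (rule cring_from_type_algebra)
  have "primeideal (PIdl\<^bsub>ring_of_type_algebra\<^esub> \<pi>) (ring_of_type_algebra :: 'a ring)"
    using assms by (intro maximalideal_prime) (simp add: uniformizer_def)
  then interpret P: primeideal "{x. \<pi> dvd x}" "ring_of_type_algebra :: 'a ring"
    by (simp add: cgenideal_type_algebra)
  have "\<not> \<pi> dvd 1"
    using P.I_notcarr by (auto dest: dvd_trans[OF _ one_dvd])
  moreover have "\<pi> dvd a \<or> \<pi> dvd b" if "\<pi> dvd a * b" for a b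
    using P.I_prime[of a b] that by simp
  ultimately show ?thesis
    using uniformizer_nonzero[OF assms] by (simp add: prime_elem_def)
qed

text \<open>A nonzero non-unit of a principal domain has an irreducible divisor, which generates a
  maximal ideal. By locality this is the ideal of \<open>\<pi>\<close>, so \<open>\<pi>\<close>
  divides the element.\<close>

lemma not_uniformizer_dvd_imp_unit:
  fixes \<pi> :: "'a::discrete_valuation_ring"
  assumes "uniformizer \<pi>" and "\<not> \<pi> dvd x"
  shows "x dvd 1"
proof (rule ccontr)
  assume "\<not> x dvd 1"
  interpret principal_domain "ring_of_type_algebra :: 'a ring"
    by (rule principal)
  have "x \<noteq> 0"
    using assms(2) by auto
  obtain p :: 'a where p: "ring_irreducible\<^bsub>ring_of_type_algebra\<^esub> p"
      and "p divides\<^bsub>ring_of_type_algebra\<^esub> x"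
  proof (rule exists_irreducible_divisor[of x])
    show "x \<in> carrier ring_of_type_algebra - {\<zero>\<^bsub>ring_of_type_algebra\<^esub>}"
      using \<open>x \<noteq> 0\<close> by simp
    show "x \<notin> Units ring_of_type_algebra"
      using \<open>\<not> x dvd 1\<close> by (simp add: Units_type_algebra)
  qed
  then have "p dvd x"
    by (auto simp: factor_def)
  have "maximalideal (PIdl\<^bsub>ring_of_type_algebra\<^esub> p) (ring_of_type_algebra :: 'a ring)"
    using p by (intro irreducible_imp_maximalideal) auto
  moreover have "maximalideal (PIdl\<^bsub>ring_of_type_algebra\<^esub> \<pi>) (ring_of_type_algebra :: 'a ring)"
    using assms(1) by (simp only: uniformizer_def)
  ultimately have eq: "PIdl\<^bsub>ring_of_type_algebra\<^esub> p = PIdl\<^bsub>ring_of_type_algebra\<^esub> \<pi>"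
    by (rule local[unfolded ex1_iff_ex_Uniq, THEN conjunct2, THEN Uniq_D])
  have "p \<in> PIdl\<^bsub>ring_of_type_algebra\<^esub> p"
    by (simp add: cgenideal_type_algebra)
  then have "\<pi> dvd p"
    unfolding eq by (simp add: cgenideal_type_algebra)
  then show False
    using \<open>p dvd x\<close> assms(2) dvd_trans by blast
qed

text \<open>If \<open>x \<noteq> 0\<close>, the quotients \<open>x / \<pi> ^ i\<close> generate a strictly increasing chain of ideals.\<close>

lemma eq_0_if_all_powers_dvd:
  fixes \<pi> :: "'a::discrete_valuation_ring"
  assumes "uniformizer \<pi>" and "\<And>i. \<pi> ^ i dvd x"
  shows "x = 0"
proof (rule ccontr)
  assume "x \<noteq> 0"
  interpret principal_domain "ring_of_type_algebra :: 'a ring"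
    by (rule principal)
  obtain y where y: "\<And>i. x = \<pi> ^ i * y i"
    using assms(2) unfolding dvd_def by metis
  have Suc: "y i = \<pi> * y (Suc i)" for i
    using y[of i] y[of "Suc i"] uniformizer_nonzero[OF assms(1)] by (auto simp: mult.assoc)
  have step: "y (Suc i) dvd y i" for i
    by (subst Suc) simp
  have mono: "y j dvd y i" if "i \<le> j" for i j
    using that by (induction rule: dec_induct) (auto intro: dvd_trans step)
  let ?C = "range (\<lambda>i. PIdl\<^bsub>ring_of_type_algebra\<^esub> (y i))"
  \<comment> \<open>A principal domain is Noetherian, so the chain contains its union. At the index
    \<open>i\<close> where it stops growing, \<open>\<pi>\<close> would be a unit.\<close>
  have "\<Union>?C \<in> ?C"
  proof (rule ideal_chain_is_trivial)
    have "{z. y j dvd z} \<subseteq> {z. y i dvd z} \<or> {z. y i dvd z} \<subseteq> {z. y j dvd z}" for i j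
      using mono[of i j] mono[of j i] nat_le_linear[of i j] by (blast intro: dvd_trans)
    then show "subset.chain {I. ideal I ring_of_type_algebra} ?C"
      unfolding subset_chain_def
      by (simp add: cgenideal_ideal image_subset_iff flip: cgenideal_type_algebra)
  qed simp
  then obtain i where "(\<Union>j. {z. y j dvd z}) = {z. y i dvd z}"
    by (auto simp: cgenideal_type_algebra)
  moreover have "y (Suc i) \<in> (\<Union>j. {z. y j dvd z})"
    by (intro UN_I[of "Suc i"]) simp_all
  ultimately have "y i dvd y (Suc i)"
    by simp
  then have "\<pi> * y (Suc i) dvd 1 * y (Suc i)"
    by (simp only: mult_1 flip: Suc)
  moreover have "y (Suc i) \<noteq> 0"
    using y[of "Suc i"] \<open>x \<noteq> 0\<close> by (metis mult_zero_right)
  ultimately have "\<pi> dvd 1"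
    by (simp only: dvd_mult_cancel_right simp_thms)
  then show False
    using uniformizer_imp_prime_elem[OF assms(1)] by (simp add: prime_elem_def)
qed

text \<open>For \<open>x \<noteq> 0\<close> the exponents \<open>i\<close> with
  \<open>\<pi> ^ i dvd x\<close> are bounded, so \<open>Max\<close> is attained. The remaining
  factor is not divisible by \<open>\<pi>\<close> and hence a unit.\<close>

lemma valuation_eq_enatE:
  fixes \<pi> x :: "'a::discrete_valuation_ring"
  assumes "uniformizer \<pi>" and "valuation \<pi> x = enat t"
  obtains w where "x = \<pi> ^ t * w" and "w dvd 1"
proof -
  have "x \<noteq> 0" and t: "t = Max {i. \<pi> ^ i dvd x}"
    using assms(2) by (auto simp: valuation_def split: if_splits)
  obtain i0 where "\<not> \<pi> ^ i0 dvd x"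
    using eq_0_if_all_powers_dvd[OF assms(1)] \<open>x \<noteq> 0\<close> by blast
  then have "{i. \<pi> ^ i dvd x} \<subseteq> {..i0}"
    using power_le_dvd nat_le_linear by auto blast
  then have fin: "finite {i. \<pi> ^ i dvd x}"
    using finite_subset by blast
  have "0 \<in> {i. \<pi> ^ i dvd x}"
    by simp
  then have "t \<in> {i. \<pi> ^ i dvd x}"
    unfolding t using fin by (intro Max_in) blast+
  then obtain w where w: "x = \<pi> ^ t * w"
    by (auto simp: dvd_def)
  have "\<not> \<pi> dvd w"
  proof
    assume "\<pi> dvd w"
    then have "\<pi> ^ Suc t dvd x"
      unfolding w by (simp add: mult_dvd_mono mult.commute)
    then have "Suc t \<le> t"
      unfolding t using fin by (intro Max_ge) simp_all
    then show False
      by simp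
  qed
  then show thesis
    using that w not_uniformizer_dvd_imp_unit[OF assms(1)] by blast
qed

section \<open>Adic limits and contractions\<close>

lemma adic_limit_poly:
  fixes \<pi> :: "'a::complete_discrete_valuation_ring"
  assumes "uniformizer \<pi>" and deg: "\<And>i. degree (U i) < m"
    and cong: "\<And>i. [:\<pi> ^ i:] dvd U (Suc i) - U i"
  shows "\<exists>l. degree l < m \<and> (\<forall>i. [:\<pi> ^ i:] dvd U i - l)"
proof -
  have cong': "\<pi> ^ i dvd coeff (U j) d - coeff (U i) d" if "i \<le> j" for i j d
    using that
  proof (induction rule: dec_induct)
    case (step j)
    have "\<pi> ^ j dvd coeff (U (Suc j) - U j) d"
      using cong[of j] by (simp only: const_poly_dvd_iff)
    then have "\<pi> ^ i dvd coeff (U (Suc j)) d - coeff (U j) d"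
      using step.hyps power_le_dvd by (metis coeff_diff)
    from dvd_add[OF this step.IH] show ?case
      by simp
  qed simp
  have "\<exists>l. adic_LIMSEQ \<pi> (\<lambda>i. coeff (U i) d) l" for d
  proof (rule complete[OF assms(1)])
    show "adic_Cauchy \<pi> (\<lambda>i. coeff (U i) d)"
      unfolding adic_Cauchy_def
    proof (intro allI exI impI)
      fix i j k :: nat assume "i \<le> j" "i \<le> k"
      from dvd_diff[OF cong'[OF this(1), of d] cong'[OF this(2), of d]]
      show "\<pi> ^ i dvd coeff (U j) d - coeff (U k) d"
        by simp
    qed
  qed
  then obtain L where L: "\<And>d. adic_LIMSEQ \<pi> (\<lambda>i. coeff (U i) d) (L d)"
    by metis
  \<comment> \<open>Convergence gives the congruence only from some index \<open>K\<close> on;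
    passing through \<open>max i K\<close> brings it back to index \<open>i\<close> itself.\<close>
  have dvd_L: "\<pi> ^ i dvd coeff (U i) d - L d" for i d
  proof -
    obtain K where K: "\<And>n. n \<ge> K \<Longrightarrow> \<pi> ^ i dvd coeff (U n) d - L d"
      using L unfolding adic_LIMSEQ_def by metis
    from dvd_diff[OF K[of "max i K"] cong'[of i "max i K" d]] show ?thesis
      by simp
  qed
  \<comment> \<open>By the common degree bound all coefficients from \<open>m\<close> on vanish, so
    the limits below \<open>m\<close> form one polynomial.\<close>
  define l where "l = (\<Sum>d<m. monom (L d) d)"
  have coeff_l: "coeff l d = (if d < m then L d else 0)" for d
    by (simp add: l_def coeff_sum)
  have "m > 0"
    using deg[of 0] by simp
  then have "degree l < m"
    by (metis coeff_l le_degree leading_coeff_0_iff degree_0 not_less0 leI)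
  moreover have "[:\<pi> ^ i:] dvd U i - l" for i
    using dvd_L deg[of i] by (auto simp: const_poly_dvd_iff coeff_l coeff_eq_0)
  ultimately show ?thesis
    by blast
qed

text \<open>Two fixed points are congruent modulo \<open>1\<close>, and each application of
  \<open>\<Phi>\<close> raises the exponent by one; only \<open>0\<close> is divisible by all powers
  of \<open>\<pi>\<close>.\<close>

lemma adic_contraction_unique:
  fixes \<pi> :: "'a::discrete_valuation_ring"
  assumes "uniformizer \<pi>"
    and contr: "\<And>i. (\<forall>k\<in>K. [:\<pi> ^ i:] dvd u k - v k) \<Longrightarrow>
                     (\<forall>k\<in>K. [:\<pi> ^ Suc i:] dvd \<Phi> u k - \<Phi> v k)"
    and fixed: "\<forall>k\<in>K. \<Phi> u k = u k" "\<forall>k\<in>K. \<Phi> v k = v k" and "k \<in> K"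
  shows "u k = v k"
proof -
  have "\<forall>k\<in>K. [:\<pi> ^ i:] dvd u k - v k" for i
  proof (induction i)
    case 0
    show ?case by (simp add: one_pCons[symmetric])
  next
    case (Suc i)
    then show ?case
      using contr[of i] fixed by simp
  qed
  then have "\<pi> ^ i dvd coeff (u k) d - coeff (v k) d" for i d
    using \<open>k \<in> K\<close> by (auto simp: const_poly_dvd_iff)
  then have "coeff (u k) d - coeff (v k) d = 0" for d
    by (rule eq_0_if_all_powers_dvd[OF assms(1)])
  then show ?thesis
    by (simp add: poly_eq_iff)
qed

text \<open>The iterates of \<open>\<Phi>\<close> from \<open>0\<close> converge. The degree bounds
  single out the families on which \<open>\<Phi>\<close> contracts, and they pass to the
  limit.\<close>

lemma adic_contraction_fixed_point:
  fixes \<pi> :: "'a::complete_discrete_valuation_ring"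
  assumes "uniformizer \<pi>"
    and pos: "\<And>k. k \<in> K \<Longrightarrow> 0 < m k"
    and deg: "\<And>u. (\<forall>k\<in>K. degree (u k) < m k) \<Longrightarrow> (\<forall>k\<in>K. degree (\<Phi> u k) < m k)"
    and contr: "\<And>i u v. (\<forall>k\<in>K. degree (u k) < m k) \<Longrightarrow> (\<forall>k\<in>K. degree (v k) < m k) \<Longrightarrow>
                  (\<forall>k\<in>K. [:\<pi> ^ i:] dvd u k - v k) \<Longrightarrow>
                  (\<forall>k\<in>K. [:\<pi> ^ Suc i:] dvd \<Phi> u k - \<Phi> v k)"
  shows "\<exists>u. (\<forall>k\<in>K. degree (u k) < m k) \<and> (\<forall>k\<in>K. \<Phi> u k = u k)"
proof -
  define U where "U i = (\<Phi> ^^ i) (\<lambda>_. 0)" for i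
  have U_Suc: "U (Suc i) = \<Phi> (U i)" for i
    by (simp add: U_def)
  have U_deg: "\<forall>k\<in>K. degree (U i k) < m k" for i
  proof (induction i)
    case 0
    show ?case using pos by (simp add: U_def)
  qed (use deg U_Suc in simp)
  have U_cong: "\<forall>k\<in>K. [:\<pi> ^ i:] dvd U (Suc i) k - U i k" for i
  proof (induction i)
    case 0
    show ?case by (simp add: one_pCons[symmetric])
  next
    case (Suc i)
    from contr[OF U_deg U_deg Suc] show ?case
      by (simp only: U_Suc)
  qed
  have "\<exists>l. degree l < m k \<and> (\<forall>i. [:\<pi> ^ i:] dvd U i k - l)" if "k \<in> K" for k
    using U_deg U_cong that by (intro adic_limit_poly[OF assms(1)]) auto
  then obtain u where u_deg: "\<forall>k\<in>K. degree (u k) < m k"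
      and u: "\<And>i k. k \<in> K \<Longrightarrow> [:\<pi> ^ i:] dvd U i k - u k"
    by metis
  have "\<Phi> u k = u k" if "k \<in> K" for k
  proof -
    \<comment> \<open>Modulo \<open>\<pi> ^ Suc i\<close>, the iterate
      \<open>\<Phi> (U i) = U (Suc i)\<close> agrees both with \<open>\<Phi> u\<close> and with
      \<open>u\<close>.\<close>
    have "\<pi> ^ i dvd coeff (\<Phi> u k - u k) d" for i d
    proof -
      have "[:\<pi> ^ Suc i:] dvd \<Phi> (U i) k - \<Phi> u k"
        using contr[OF U_deg u_deg, of i i] u \<open>k \<in> K\<close> by simp
      moreover have "[:\<pi> ^ Suc i:] dvd \<Phi> (U i) k - u k"
        using u[OF \<open>k \<in> K\<close>, of "Suc i"] by (simp only: U_Suc)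
      ultimately have "[:\<pi> ^ Suc i:] dvd (\<Phi> (U i) k - u k) - (\<Phi> (U i) k - \<Phi> u k)"
        by (rule dvd_diff[rotated])
      then have "[:\<pi> ^ Suc i:] dvd \<Phi> u k - u k"
        by simp
      then have "\<pi> ^ Suc i dvd coeff (\<Phi> u k - u k) d"
        by (simp only: const_poly_dvd_iff)
      then show ?thesis
        using power_le_dvd le_SucI le_refl by metis
    qed
    then have "coeff (\<Phi> u k - u k) d = 0" for d
      by (rule eq_0_if_all_powers_dvd[OF assms(1)])
    then show ?thesis
      by (simp add: poly_eq_iff)
  qed
  then show ?thesis
    using u_deg by blast
qed

section \<open>Polynomials modulo a prime element\<close>

text \<open>
  Since \<open>g j\<close> is congruent to \<open>X ^ m j\<close>, every term of the product of the \<open>g j\<close> that has fewer than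
  \<open>c\<close> factors divisible by \<open>\<pi>\<close> contains more than \<open>card S - c\<close> of the powers \<open>X ^ m j\<close>.
\<close>

lemma power_dvd_coeff_prod:
  fixes \<pi> :: "'a::comm_ring_1" and m :: "'b \<Rightarrow> nat"
  assumes "finite S" and "\<And>j. j \<in> S \<Longrightarrow> [:\<pi>:] dvd g j - monom 1 (m j)"
    and "\<And>T. T \<subseteq> S \<Longrightarrow> card S < card T + c \<Longrightarrow> i < sum m T"
  shows "\<pi> ^ c dvd coeff (prod g S) i"
  using assms
proof (induction S arbitrary: c i rule: finite_induct)
  case empty
  from empty.prems(2)[of "{}"] show ?case
    by (cases c) auto
next
  case (insert k S)
  obtain r where "g k - monom 1 (m k) = [:\<pi>:] * r"
    using insert.prems(1)[of k] by (auto elim: dvdE)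
  then have "g k = monom 1 (m k) + smult \<pi> r"
    by (simp add: algebra_simps)
  \<comment> \<open>The monomial term shifts the index by \<open>m k\<close> and keeps
    \<open>c\<close>. The other term supplies one factor \<open>\<pi>\<close>, so there the
    induction hypothesis is applied with \<open>c\<close> lowered by one.\<close>
  then have prod: "prod g (insert k S) = monom 1 (m k) * prod g S + smult \<pi> (r * prod g S)"
    using insert.hyps by (simp add: distrib_right)
  have IH: "\<pi> ^ d dvd coeff (prod g S) j"
    if "\<And>T. T \<subseteq> S \<Longrightarrow> card S < card T + d \<Longrightarrow> j < sum m T" for d j
    using insert.IH[of d j] insert.prems(1) that by simp
  have "\<pi> ^ c dvd coeff (monom 1 (m k) * prod g S) i"
  proof (cases "i < m k")
    case False
    have "\<pi> ^ c dvd coeff (prod g S) (i - m k)"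
    proof (rule IH)
      fix T assume T: "T \<subseteq> S" "card S < card T + c"
      then have "k \<notin> T" "finite T"
        using insert.hyps finite_subset by auto
      then have "i < sum m (insert k T)"
        using T insert.hyps by (intro insert.prems(2)) auto
      then show "i - m k < sum m T"
        using \<open>k \<notin> T\<close> \<open>finite T\<close> False by simp
    qed
    then show ?thesis
      using False by (simp add: coeff_monom_mult)
  qed (simp add: coeff_monom_mult)
  moreover have "\<pi> ^ c dvd \<pi> * coeff (r * prod g S) i"
  proof (cases c)
    case (Suc d)
    have "\<pi> ^ d dvd coeff (prod g S) j" if "j \<le> i" for j
    proof (rule IH)
      fix T assume T: "T \<subseteq> S" "card S < card T + d"
      then have "i < sum m T"
        using insert.hyps Suc by (intro insert.prems(2)) auto
      then show "j < sum m T"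
        using that by simp
    qed
    then have "\<pi> ^ d dvd coeff (r * prod g S) i"
      unfolding coeff_mult by (intro dvd_sum dvd_mult) simp
    then show ?thesis
      by (simp add: Suc mult_dvd_mono)
  qed simp
  ultimately show ?case
    by (simp add: prod)
qed

text \<open>The argument of Gauss's lemma: let \<open>k\<close> and \<open>l\<close> be the first
  indices at which \<open>p\<close> and \<open>q\<close> have coefficients not divisible by
  \<open>\<pi>\<close>. Modulo \<open>\<pi>\<close>, coefficient \<open>k + l\<close> of
  \<open>p * q\<close> is the product of these two, and \<open>\<pi>\<close> is prime.\<close>

lemma prime_elem_dvd_coeff_factor:
  fixes \<pi> :: "'a::idom"
  assumes "prime_elem \<pi>" and "\<not> \<pi> dvd coeff q b" and "i < a"
    and dvd: "\<And>j. j < a + b \<Longrightarrow> \<pi> dvd coeff (p * q) j"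
  shows "\<pi> dvd coeff p i"
proof (rule ccontr)
  assume i: "\<not> \<pi> dvd coeff p i"
  define k where "k = (LEAST k. \<not> \<pi> dvd coeff p k)"
  define l where "l = (LEAST l. \<not> \<pi> dvd coeff q l)"
  have k: "\<not> \<pi> dvd coeff p k" "k \<le> i"
    using LeastI[of "\<lambda>n. \<not> \<pi> dvd coeff p n", OF i]
      Least_le[of "\<lambda>n. \<not> \<pi> dvd coeff p n", OF i]
    unfolding k_def by - assumption+
  have less_k: "\<pi> dvd coeff p j" if "j < k" for j
    using not_less_Least[of j "\<lambda>n. \<not> \<pi> dvd coeff p n"] that unfolding k_def by blast
  have l: "\<not> \<pi> dvd coeff q l" "l \<le> b"
    using LeastI[of "\<lambda>n. \<not> \<pi> dvd coeff q n", OF assms(2)]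
      Least_le[of "\<lambda>n. \<not> \<pi> dvd coeff q n", OF assms(2)]
    unfolding l_def by - assumption+
  have less_l: "\<pi> dvd coeff q j" if "j < l" for j
    using not_less_Least[of j "\<lambda>n. \<not> \<pi> dvd coeff q n"] that unfolding l_def by blast
  have "coeff (p * q) (k + l) =
      coeff p k * coeff q l + (\<Sum>j\<in>{..k + l} - {k}. coeff p j * coeff q (k + l - j))"
    unfolding coeff_mult by (subst sum.remove[of _ k]) auto
  moreover have "\<pi> dvd (\<Sum>j\<in>{..k + l} - {k}. coeff p j * coeff q (k + l - j))"
  proof (rule dvd_sum)
    fix j assume "j \<in> {..k + l} - {k}"
    then have "j < k \<or> k + l - j < l"
      by auto
    then show "\<pi> dvd coeff p j * coeff q (k + l - j)"
      using less_k less_l by auto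
  qed
  moreover have "\<pi> dvd coeff (p * q) (k + l)"
    using k(2) l(2) assms(3) by (intro dvd) simp
  ultimately have "\<pi> dvd coeff p k * coeff q l"
    by (simp only: dvd_add_left_iff)
  then show False
    using k(1) l(1) assms(1) prime_elem_dvd_mult_iff by blast
qed

text \<open>Otherwise the coefficients at the larger of the two degrees would show that
  \<open>c\<close> divides \<open>1\<close>.\<close>

lemma monic_cong_degree_eq:
  fixes p q :: "'a::idom poly"
  assumes "lead_coeff p = 1" and "lead_coeff q = 1" and "[:c:] dvd p - q" and "\<not> c dvd 1"
  shows "degree p = degree q"
proof (rule ccontr)
  have dvd: "c dvd coeff p i - coeff q i" for i
    using assms(3) by (auto simp: const_poly_dvd_iff)
  assume "degree p \<noteq> degree q"
  then consider "degree p < degree q" | "degree q < degree p"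
    by linarith
  then show False
  proof cases
    case 1
    then show False
      using dvd[of "degree q"] assms(2,4) by (simp add: coeff_eq_0)
  next
    case 2
    then show False
      using dvd[of "degree p"] assms(1,4) by (simp add: coeff_eq_0)
  qed
qed

lemma degree_diff_monic_less:
  fixes p q :: "'a::comm_ring_1 poly"
  assumes "lead_coeff p = 1" and "lead_coeff q = 1" and "degree p = N" and "degree q = N" and "0 < N"
  shows "degree (p - q) < N"
proof -
  have "coeff (p - q) i = 0" if "N - 1 < i" for i
  proof (cases "i = N")
    case False
    then show ?thesis
      using that assms(3,4) by (simp add: coeff_eq_0)
  qed (use assms in auto)
  then have "degree (p - q) \<le> N - 1"
    by (intro degree_le) blast
  then show ?thesis
    using assms(5) by simp
qed

lemma lead_coeff_prod_monic:
  fixes g :: "'b \<Rightarrow> 'a::idom poly"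
  assumes "\<And>k. k \<in> S \<Longrightarrow> lead_coeff (g k) = 1"
  shows "lead_coeff (prod g S) = 1"
  unfolding lead_coeff_prod using assms by (intro prod.neutral) blast

lemma degree_prod_monic:
  fixes g :: "'b \<Rightarrow> 'a::idom poly"
  assumes "\<And>k. k \<in> S \<Longrightarrow> lead_coeff (g k) = 1"
  shows "degree (prod g S) = (\<Sum>k\<in>S. degree (g k))"
proof (rule degree_prod_eq_sum_degree)
  show "\<forall>k\<in>S. g k \<noteq> 0"
  proof
    fix k assume "k \<in> S"
    from assms[OF this] show "g k \<noteq> 0"
      by auto
  qed
qed

text \<open>Modulo the prime \<open>\<pi>\<close> the coefficients lie in a domain, and there a
  monic divisor of a power of \<open>X\<close> is itself a power of \<open>X\<close>.\<close>

lemma monic_factor_cong_monom: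
  fixes p q :: "'a::idom poly"
  assumes "prime_elem \<pi>" and "lead_coeff p = 1" and "lead_coeff q = 1"
    and dvd: "[:\<pi>:] dvd p * q - monom 1 (degree p + degree q)"
  shows "[:\<pi>:] dvd p - monom 1 (degree p)"
  unfolding const_poly_dvd_iff
proof
  fix i
  have "\<not> \<pi> dvd 1"
    using assms(1) by (simp add: prime_elem_def)
  have dvd': "\<pi> dvd coeff (p * q) j" if "j < degree p + degree q" for j
  proof -
    have "\<pi> dvd coeff (p * q - monom 1 (degree p + degree q)) j"
      using dvd unfolding const_poly_dvd_iff by blast
    then show ?thesis
      using that by simp
  qed
  consider "i < degree p" | "i = degree p" | "degree p < i"
    by linarith
  then show "\<pi> dvd coeff (p - monom 1 (degree p)) i"
  proof cases
    case 1
    have "\<pi> dvd coeff p i"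
      using assms(3) \<open>\<not> \<pi> dvd 1\<close>
      by (intro prime_elem_dvd_coeff_factor[OF assms(1) _ 1 dvd']) auto
    then show ?thesis
      using 1 by simp
  qed (use assms(2) in \<open>auto simp: coeff_eq_0\<close>)
qed

section \<open>Matrices with divisible columns\<close>

text \<open>Every term of the Leibniz formula takes exactly one entry from each column.\<close>

lemma prod_power_dvd_det:
  fixes \<pi> :: "'a::comm_ring_1"
  assumes "A \<in> carrier_mat N N"
    and "\<And>i j. i < N \<Longrightarrow> j < N \<Longrightarrow> \<pi> ^ c j dvd A $$ (i, j)"
  shows "\<pi> ^ (\<Sum>j<N. c j) dvd det A"
  unfolding det_def'[OF assms(1)]
proof (intro dvd_sum dvd_mult)
  fix p assume "p \<in> {p. p permutes {0..<N}}"
  then have p: "p permutes {0..<N}"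
    by simp
  have "(\<Sum>j<N. c j) = (\<Sum>i = 0..<N. c (p i))"
    using sum.permute[OF p, of c] by (simp add: atLeast0LessThan comp_def)
  then have "\<pi> ^ (\<Sum>j<N. c j) = (\<Prod>i = 0..<N. \<pi> ^ c (p i))"
    by (simp add: power_sum)
  also have "\<dots> dvd (\<Prod>i = 0..<N. A $$ (i, p i))"
    using assms(2) permutes_in_image[OF p] by (intro prod_dvd_prod) auto
  finally show "\<pi> ^ (\<Sum>j<N. c j) dvd (\<Prod>i = 0..<N. A $$ (i, p i))" .
qed

text \<open>Up to sign, entry \<open>(i, j)\<close> of the adjugate is the minor without row
  \<open>j\<close> and column \<open>i\<close>, so only the \<open>c i\<close> factors of that
  column are lost.\<close>

lemma prod_power_dvd_adj_mat:
  fixes \<pi> :: "'a::comm_ring_1"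
  assumes A: "A \<in> carrier_mat N N"
    and dvd: "\<And>i j. i < N \<Longrightarrow> j < N \<Longrightarrow> \<pi> ^ c j dvd A $$ (i, j)"
    and "i < N" and "j < N" and "e + c i \<le> (\<Sum>j<N. c j)"
  shows "\<pi> ^ e dvd adj_mat A $$ (i, j)"
proof -
  obtain N' where N: "N = Suc N'"
    using \<open>i < N\<close> by (cases N) auto
  have image: "insert_index i ` {..<N'} = {..<N} - {i}"
    using insert_index_image[of i N'] assms(3) by (simp add: N atLeast0LessThan)
  have "e \<le> (\<Sum>j\<in>{..<N} - {i}. c j)"
    using assms(3,5) by (simp add: sum.remove[of _ i])
  also have "\<dots> = (\<Sum>j<N'. c (insert_index i j))"
    unfolding image[symmetric] by (subst sum.reindex) (auto intro: inj_on_subset[OF insert_index_inj_on])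
  finally have "\<pi> ^ e dvd \<pi> ^ (\<Sum>j<N'. c (insert_index i j))"
    by (rule le_imp_power_dvd)
  also have "\<dots> dvd det (mat_delete A j i)"
  proof (rule prod_power_dvd_det)
    show "mat_delete A j i \<in> carrier_mat N' N'"
      using mat_delete_carrier[OF A] by (simp add: N)
    fix k l assume kl: "k < N'" "l < N'"
    have "insert_index j k < N" "insert_index i l < N"
      using kl by (auto simp: insert_index_def N)
    then show "\<pi> ^ c (insert_index i l) dvd mat_delete A j i $$ (k, l)"
      using dvd[of "insert_index j k" "insert_index i l"]
        mat_delete_index[of A N' j i k l] A kl assms(3,4) by (simp add: N)
  qed
  finally show ?thesis
    using A assms(3,4) by (simp add: adj_mat_def cofactor_def)
qed

lemma transpose_mult_vec_eq_0:
  fixes A :: "'a::idom mat"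
  assumes A: "A \<in> carrier_mat N N" and "det A \<noteq> 0" and y: "y \<in> carrier_vec N"
    and "transpose_mat A *\<^sub>v y = 0\<^sub>v N"
  shows "y = 0\<^sub>v N"
proof (rule ccontr)
  assume "y \<noteq> 0\<^sub>v N"
  then have "det (transpose_mat A) = 0"
    using assms by (subst det_0_iff_vec_prod_zero[of _ N]) auto
  then show False
    using det_transpose[OF A] \<open>det A \<noteq> 0\<close> by simp
qed

text \<open>Cramer's rule: the transposed adjugate applied to \<open>b\<close> solves the system
  with right-hand side \<open>det A \<cdot>\<^sub>v b\<close>. As \<open>\<pi> ^ e\<close> divides
  the adjugate, it can be cancelled from the \<open>e + t\<close> factors \<open>\<pi>\<close> of
  the determinant.\<close>

lemma transpose_mult_vec_solvable:
  fixes A :: "'a::idom mat"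
  assumes A: "A \<in> carrier_mat N N" and "\<pi> \<noteq> 0"
    and dvd: "\<And>i j. i < N \<Longrightarrow> j < N \<Longrightarrow> \<pi> ^ c j dvd A $$ (i, j)"
    and e: "\<And>i. i < N \<Longrightarrow> e + c i \<le> (\<Sum>j<N. c j)"
    and det: "det A = \<pi> ^ (e + t) * w" and "w dvd 1"
    and b: "b \<in> carrier_vec N"
  shows "\<exists>y\<in>carrier_vec N. transpose_mat A *\<^sub>v y = \<pi> ^ t \<cdot>\<^sub>v b"
proof -
  note adj = adj_mat[OF A]
  have smult: "transpose_mat A *\<^sub>v (k \<cdot>\<^sub>v x) = k \<cdot>\<^sub>v (transpose_mat A *\<^sub>v x)"
    if "x \<in> carrier_vec N" for k x
    using A that by (intro eq_vecI) simp_all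
  define v where "v = transpose_mat (adj_mat A) *\<^sub>v b"
  have v: "v \<in> carrier_vec N"
    using adj(1) b by (simp add: v_def)
  have "transpose_mat A *\<^sub>v v = transpose_mat A * transpose_mat (adj_mat A) *\<^sub>v b"
    unfolding v_def using A adj(1) b by (intro assoc_mult_mat_vec[symmetric]) auto
  also have "transpose_mat A * transpose_mat (adj_mat A) = transpose_mat (adj_mat A * A)"
    using A adj(1) by (intro transpose_mult[symmetric])
  also have "\<dots> = det A \<cdot>\<^sub>m 1\<^sub>m N"
    unfolding adj(3) by auto
  also have "\<dots> *\<^sub>v b = det A \<cdot>\<^sub>v b"
    using b by (intro eq_vecI) (auto simp: smult_scalar_prod_distrib[of _ N])
  finally have Av: "transpose_mat A *\<^sub>v v = det A \<cdot>\<^sub>v b" .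
  have "\<exists>z. v $ i = \<pi> ^ e * z" if "i < N" for i
  proof -
    have "v $ i = (\<Sum>j<N. adj_mat A $$ (j, i) * b $ j)"
      using that adj(1) b by (simp add: v_def scalar_prod_def atLeast0LessThan)
    also have "\<pi> ^ e dvd \<dots>"
    proof (intro dvd_sum dvd_mult2)
      fix j assume "j \<in> {..<N}"
      show "\<pi> ^ e dvd adj_mat A $$ (j, i)"
        using \<open>j \<in> {..<N}\<close> that e[of j] by (intro prod_power_dvd_adj_mat[OF A dvd]) auto
    qed
    finally show ?thesis
      by (auto elim: dvdE)
  qed
  then obtain z where z: "\<And>i. i < N \<Longrightarrow> v $ i = \<pi> ^ e * z i"
    by metis
  obtain w' where w': "w * w' = 1"
    using \<open>w dvd 1\<close> by (metis dvdE)
  have vz: "v = \<pi> ^ e \<cdot>\<^sub>v vec N z"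
    using v z by (intro eq_vecI) auto
  have "\<pi> ^ e \<cdot>\<^sub>v (transpose_mat A *\<^sub>v vec N z) = transpose_mat A *\<^sub>v v"
    unfolding vz by (subst smult) simp_all
  also have "\<dots> = \<pi> ^ e \<cdot>\<^sub>v ((\<pi> ^ t * w) \<cdot>\<^sub>v b)"
    unfolding Av by (simp add: det smult_smult_assoc power_add mult.assoc)
  finally have "\<pi> ^ e \<cdot>\<^sub>v (transpose_mat A *\<^sub>v vec N z) = \<pi> ^ e \<cdot>\<^sub>v ((\<pi> ^ t * w) \<cdot>\<^sub>v b)" .
  then have Az: "transpose_mat A *\<^sub>v vec N z = (\<pi> ^ t * w) \<cdot>\<^sub>v b"
    using A b \<open>\<pi> \<noteq> 0\<close> by (auto simp: vec_eq_iff)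
  have "transpose_mat A *\<^sub>v (w' \<cdot>\<^sub>v vec N z) = w' \<cdot>\<^sub>v ((\<pi> ^ t * w) \<cdot>\<^sub>v b)"
    by (subst smult) (simp_all add: Az)
  also have "\<dots> = (\<pi> ^ t * (w * w')) \<cdot>\<^sub>v b"
    by (simp add: smult_smult_assoc ac_simps)
  also have "\<dots> = \<pi> ^ t \<cdot>\<^sub>v b"
    by (simp add: w')
  finally show ?thesis
    by (intro bexI[of _ "w' \<cdot>\<^sub>v vec N z"]) auto
qed

section \<open>The generalised Sylvester matrix\<close>

text \<open>Induction on the cardinality, removing the maximum of \<open>T\<close>: it is at least
  \<open>card T\<close>, so by monotonicity its value is at least \<open>m (card T)\<close>.\<close>

lemma sum_initial_segment_le:
  fixes m :: "nat \<Rightarrow> nat"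
  assumes "mono_on {1..n} m" and "T \<subseteq> {1..n}"
  shows "(\<Sum>j=1..card T. m j) \<le> sum m T"
  using assms(2)
proof (induction "card T" arbitrary: T)
  case (Suc l)
  have "finite T"
    using Suc.prems finite_subset by blast
  moreover have "T \<noteq> {}"
    using Suc.hyps(2) by auto
  ultimately have Max: "Max T \<in> T" "T \<subseteq> {1..Max T}"
    using Suc.prems by auto
  have "card T \<le> Max T"
    using card_mono[OF _ Max(2)] by simp
  then have "m (card T) \<le> m (Max T)"
    using Max(1) Suc.prems Suc.hyps(2) by (intro mono_onD[OF assms(1)]) auto
  moreover have card: "card (T - {Max T}) = l"
    using Suc.hyps(2) Max(1) by (simp add: card_Diff_singleton)
  then have "(\<Sum>j=1..l. m j) \<le> sum m (T - {Max T})"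
    using Suc.hyps(1)[of "T - {Max T}"] Suc.prems by auto
  moreover have "sum m T = m (Max T) + sum m (T - {Max T})"
    using Max(1) \<open>finite T\<close> by (intro sum.remove)
  ultimately show ?case
    by (simp flip: Suc.hyps(2))
qed simp

text \<open>On the right, \<open>m j\<close> occurs once for each \<open>d\<close> with
  \<open>j \<le> d < n\<close>, hence \<open>n - j\<close> times. This links the sum in the
  definition of \<open>t'\<close> to the total column exponent.\<close>

lemma sum_partial_sums:
  fixes m :: "nat \<Rightarrow> nat"
  assumes "n \<ge> 1"
  shows "(\<Sum>j=1..n-1. (int n - int j) * int (m j) - 1) =
         int (\<Sum>d=1..<n. \<Sum>j=1..d. m j) - int (n - 1)"
  using assms
proof (induction n rule: nat_induct_at_least)
  case (Suc n)
  have "(\<Sum>j=1..n. (int (Suc n) - int j) * int (m j) - 1) =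
      (\<Sum>j=1..n. ((int n - int j) * int (m j) - 1) + int (m j))"
    by (intro sum.cong) (simp_all add: algebra_simps)
  also have "\<dots> = (\<Sum>j=1..n. (int n - int j) * int (m j) - 1) + int (\<Sum>j=1..n. m j)"
    by (simp add: sum.distrib)
  \<comment> \<open>The term for \<open>j = n\<close> has the factor \<open>n - n = 0\<close> and
    contributes only \<open>-1\<close>.\<close>
  also have "(\<Sum>j=1..n. (int n - int j) * int (m j) - 1) =
      (\<Sum>j=1..n-1. (int n - int j) * int (m j) - 1) - 1"
    using Suc.hyps by (cases n) simp_all
  finally show ?case
    using Suc by (simp add: of_nat_diff)
qed simp

text \<open>Double counting of the pairs \<open>(q, d)\<close> with \<open>q\<close> below the
  partial sum up to \<open>d\<close>. No partial sum exceeds the total, so the range of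
  \<open>q\<close> cuts nothing off.\<close>

lemma sum_card_partial_sums:
  fixes m :: "nat \<Rightarrow> nat"
  shows "(\<Sum>q<\<Sum>j=1..n. m j. card {d \<in> {1..<n}. q < (\<Sum>j=1..d. m j)}) =
         (\<Sum>d=1..<n. \<Sum>j=1..d. m j)"
proof -
  let ?N = "\<Sum>j=1..n. m j"
  let ?P = "\<lambda>d q. q < (\<Sum>j=1..d. m j)"
  have "(\<Sum>q<?N. card {d \<in> {1..<n}. ?P d q}) = (\<Sum>q<?N. \<Sum>d=1..<n. if ?P d q then 1 else 0)"
    by (simp add: sum.If_cases Int_def)
  also have "\<dots> = (\<Sum>d=1..<n. \<Sum>q<?N. if ?P d q then 1 else 0)"
    by (rule sum.swap)
  also have "\<dots> = (\<Sum>d=1..<n. \<Sum>j=1..d. m j)"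
  proof (rule sum.cong)
    fix d assume "d \<in> {1..<n}"
    then have "(\<Sum>j=1..d. m j) \<le> ?N"
      by (intro sum_mono2) auto
    then have "{q \<in> {..<?N}. ?P d q} = {..<\<Sum>j=1..d. m j}"
      by auto
    then show "(\<Sum>q<?N. if ?P d q then 1 else 0) = (\<Sum>j=1..d. m j)"
      by (simp add: sum.If_cases Int_def)
  qed simp
  finally show ?thesis .
qed

text \<open>If entry \<open>i\<close> is \<open>(k, p)\<close>, then row \<open>i\<close> of the
  Sylvester matrix is row \<open>p\<close> of block \<open>k\<close>. The shape copies that of
  \<open>sylv\<close>, so that the rows are a \<open>map\<close> over this list.\<close>

definition sylv_indices :: "nat \<Rightarrow> (nat \<Rightarrow> 'a::comm_ring_1 poly) \<Rightarrow> (nat \<times> nat) list" where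
  "sylv_indices n g = concat (map (\<lambda>k. map (Pair k) [0..<degree (g k)]) [1..<n + 1])"

lemma set_sylv_indices: "set (sylv_indices n g) = (SIGMA k:{1..n}. {..<degree (g k)})"
  by (auto simp: sylv_indices_def)

lemma length_sylv_indices: "length (sylv_indices n g) = sylv_size n g"
proof -
  have "length (sylv_indices n g) = sum_list (map (degree \<circ> g) [1..<n + 1])"
    by (simp add: sylv_indices_def length_concat comp_def)
  also have "\<dots> = sum (degree \<circ> g) {1..n}"
    by (subst sum_list_distinct_conv_sum_set)
      (simp_all only: set_upt distinct_upt Suc_eq_plus1[symmetric] atLeastLessThanSuc_atLeastAtMost)
  finally show ?thesis
    by (simp add: sylv_size_def)
qed

text \<open>The list has as many different entries as its length, so it enumerates the pairs without
  repetition.\<close>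

lemma bij_betw_sylv_indices:
  "bij_betw ((!) (sylv_indices n g)) {..<sylv_size n g} (SIGMA k:{1..n}. {..<degree (g k)})"
proof (rule bij_betw_nth)
  have "card (set (sylv_indices n g)) = sylv_size n g"
    by (simp add: set_sylv_indices sylv_size_def)
  then show "distinct (sylv_indices n g)"
    by (intro card_distinct) (simp add: length_sylv_indices)
qed (simp_all add: length_sylv_indices set_sylv_indices)

lemma sylv_carrier: "sylv n g \<in> carrier_mat (sylv_size n g) (sylv_size n g)"
proof -
  have "sylv n g = mat_of_rows (sylv_size n g) (map (\<lambda>(k, p). sylv_row n g k p) (sylv_indices n g))"
    by (simp add: sylv_def sylv_indices_def map_concat comp_def)
  also have "\<dots> \<in> carrier_mat (sylv_size n g) (sylv_size n g)"
    using mat_of_rows_carrier(1)[of _ "map (\<lambda>(k, p). sylv_row n g k p) (sylv_indices n g)"]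
    by (simp add: length_sylv_indices)
  finally show ?thesis .
qed

lemma sylv_index:
  assumes "i < sylv_size n g" and "q < sylv_size n g" and "sylv_indices n g ! i = (k, p)"
  shows "sylv n g $$ (i, q) = sylv_row n g k p $ q"
proof -
  have "sylv n g = mat_of_rows (sylv_size n g) (map (\<lambda>(k, p). sylv_row n g k p) (sylv_indices n g))"
    by (simp add: sylv_def sylv_indices_def map_concat comp_def)
  then show ?thesis
    using assms by (simp add: mat_of_rows_index length_sylv_indices)
qed

text \<open>The coefficients of the family \<open>u\<close> in the order of the rows, ready for
  multiplication by the transposed matrix.\<close>

definition sylv_vec :: "nat \<Rightarrow> (nat \<Rightarrow> 'a::comm_ring_1 poly) \<Rightarrow> (nat \<Rightarrow> 'a poly) \<Rightarrow> 'a vec" where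
  "sylv_vec n g u =
     vec (sylv_size n g) (\<lambda>i. case sylv_indices n g ! i of (k, p) \<Rightarrow> coeff (u k) p)"

lemma sylv_vec_carrier [simp]: "sylv_vec n g u \<in> carrier_vec (sylv_size n g)"
  by (simp add: sylv_vec_def)

lemma sylv_vec_surj:
  assumes "y \<in> carrier_vec (sylv_size n g)" and "\<And>k. k \<in> {1..n} \<Longrightarrow> 0 < degree (g k)"
  obtains u where "y = sylv_vec n g u" and "\<And>k. k \<in> {1..n} \<Longrightarrow> degree (u k) < degree (g k)"
proof -
  define r where "r = the_inv_into {..<sylv_size n g} ((!) (sylv_indices n g))"
  have r: "r (sylv_indices n g ! i) = i" if "i < sylv_size n g" for i
    using that bij_betw_sylv_indices[of n g] unfolding r_def bij_betw_def
    by (simp add: the_inv_into_f_f)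
  define u where "u k = (\<Sum>p<degree (g k). monom (y $ r (k, p)) p)" for k
  have coeff_u: "coeff (u k) p = (if p < degree (g k) then y $ r (k, p) else 0)" for k p
    by (simp add: u_def coeff_sum)
  \<comment> \<open>Positivity of \<open>degree (g k)\<close> covers the case
    \<open>u k = 0\<close>, where the degree is \<open>0\<close>.\<close>
  have "degree (u k) < degree (g k)" if "k \<in> {1..n}" for k
    using assms(2)[OF that]
    by (metis coeff_u leading_coeff_0_iff degree_0)
  moreover have "y = sylv_vec n g u"
  proof (rule eq_vecI)
    fix i assume "i < dim_vec (sylv_vec n g u)"
    then have i: "i < sylv_size n g"
      by (simp add: sylv_vec_def)
    obtain k p where kp: "sylv_indices n g ! i = (k, p)"
      by fastforce
    then have "p < degree (g k)"
      using bij_betw_apply[OF bij_betw_sylv_indices[of n g], of i] i by simp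
    then show "y $ i = sylv_vec n g u $ i"
      using r[OF i] i by (simp add: sylv_vec_def kp coeff_u)
  qed (use assms(1) in \<open>simp add: sylv_vec_def\<close>)
  ultimately show thesis
    using that by blast
qed

lemma sylv_vec_eq_0D:
  assumes "sylv_vec n g u = 0\<^sub>v (sylv_size n g)" and "k \<in> {1..n}" and "degree (u k) < degree (g k)"
  shows "u k = 0"
proof (rule poly_eqI)
  fix p
  show "coeff (u k) p = coeff 0 p"
  proof (cases "p < degree (g k)")
    case True
    then have "(k, p) \<in> (!) (sylv_indices n g) ` {..<sylv_size n g}"
      using bij_betw_sylv_indices[of n g] assms(2) unfolding bij_betw_def by simp
    then obtain i where "i < sylv_size n g" "sylv_indices n g ! i = (k, p)"
      by auto
    then have "sylv_vec n g u $ i = coeff (u k) p"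
      by (simp add: sylv_vec_def)
    then show ?thesis
      using assms(1) \<open>i < sylv_size n g\<close> by simp
  qed (use assms(3) in \<open>simp add: coeff_eq_0\<close>)
qed

lemma degree_sylv_cofactor_le:
  assumes "k \<in> {1..n}"
  shows "degree (sylv_cofactor n g k) \<le> sylv_size n g - degree (g k)"
proof -
  have "degree (sylv_cofactor n g k) \<le> sum (degree \<circ> g) ({1..n} - {k})"
    unfolding sylv_cofactor_def by (intro degree_prod_sum_le) simp
  then show ?thesis
    using assms by (simp add: sylv_size_def sum.remove[of _ k])
qed

text \<open>Row \<open>p\<close> of block \<open>k\<close> lists the coefficients of
  \<open>X ^ p * sylv_cofactor n g k\<close>; weighting the rows with the coefficients of
  \<open>u\<close> therefore yields the combination of the cofactors.\<close>

lemma transpose_sylv_mult_vec: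
  assumes "q < sylv_size n g" and deg: "\<And>k. k \<in> {1..n} \<Longrightarrow> degree (u k) < degree (g k)"
  shows "(transpose_mat (sylv n g) *\<^sub>v sylv_vec n g u) $ q =
         coeff (\<Sum>k=1..n. u k * sylv_cofactor n g k) q"
proof -
  let ?N = "sylv_size n g"
  let ?h = "\<lambda>(k, p). sylv_row n g k p $ q * coeff (u k) p"
  have "(transpose_mat (sylv n g) *\<^sub>v sylv_vec n g u) $ q =
      (\<Sum>i<?N. sylv n g $$ (i, q) * sylv_vec n g u $ i)"
    using sylv_carrier[of n g] assms(1)
    by (simp add: scalar_prod_def atLeast0LessThan sylv_vec_def)
  also have "\<dots> = (\<Sum>i<?N. ?h (sylv_indices n g ! i))"
    using assms(1) by (intro sum.cong) (auto simp: sylv_vec_def sylv_index split: prod.splits)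
  also have "\<dots> = sum ?h (SIGMA k:{1..n}. {..<degree (g k)})"
    by (rule sum.reindex_bij_betw[OF bij_betw_sylv_indices])
  also have "\<dots> = (\<Sum>k=1..n. \<Sum>p<degree (g k). ?h (k, p))"
    by (subst sum.Sigma) auto
  also have "\<dots> = (\<Sum>k=1..n. coeff (u k * sylv_cofactor n g k) q)"
  proof (rule sum.cong)
    fix k assume k: "k \<in> {1..n}"
    \<comment> \<open>The restriction to \<open>p \<le> q\<close> keeps the subtraction
      \<open>q - p\<close> exact. The upper cutoff in \<open>sylv_row\<close> affects only
      coefficients beyond the degree of the cofactor, which are \<open>0\<close>.\<close>
    have "(\<Sum>p<degree (g k). ?h (k, p)) =
        (\<Sum>p\<in>{..<degree (g k)} \<inter> {..q}. coeff (u k) p * coeff (sylv_cofactor n g k) (q - p))"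
      using assms(1) degree_sylv_cofactor_le[OF k, of g]
      by (intro sum.mono_neutral_cong_right) (auto simp: sylv_row_def coeff_eq_0 mult.commute)
    also have "\<dots> = coeff (u k * sylv_cofactor n g k) q"
      unfolding coeff_mult
    proof (intro sum.mono_neutral_left ballI)
      fix p assume "p \<in> {..q} - {..<degree (g k)} \<inter> {..q}"
      then have "coeff (u k) p = 0"
        using deg[OF k] by (intro coeff_eq_0) auto
      then show "coeff (u k) p * coeff (sylv_cofactor n g k) (q - p) = 0"
        by simp
    qed auto
    finally show "(\<Sum>p<degree (g k). ?h (k, p)) = coeff (u k * sylv_cofactor n g k) q" .
  qed simp
  finally show ?thesis
    by (simp add: coeff_sum)
qed

text \<open>An entry of column \<open>q\<close> is \<open>0\<close> or a coefficient of a cofactor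
  at an index at most \<open>q\<close>. The estimate for coefficients of products applies, with the
  number of partial degree sums above \<open>q\<close> as exponent.\<close>

lemma power_dvd_sylv_index:
  fixes \<pi> :: "'a::comm_ring_1"
  assumes mono: "mono_on {1..n} (\<lambda>j. degree (g j))"
    and cong: "\<And>j. j \<in> {1..n} \<Longrightarrow> [:\<pi>:] dvd g j - monom 1 (degree (g j))"
    and "i < sylv_size n g" and "q < sylv_size n g"
  shows "\<pi> ^ card {d \<in> {1..<n}. q < (\<Sum>j=1..d. degree (g j))} dvd sylv n g $$ (i, q)"
proof -
  let ?D = "{d \<in> {1..<n}. q < (\<Sum>j=1..d. degree (g j))}"
  obtain k p where kp: "sylv_indices n g ! i = (k, p)"
    by fastforce
  then have k: "k \<in> {1..n}"
    using bij_betw_apply[OF bij_betw_sylv_indices[of n g], of i] assms(3) by simp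
  have "\<pi> ^ card ?D dvd coeff (sylv_cofactor n g k) (q - p)"
    unfolding sylv_cofactor_def
  proof (rule power_dvd_coeff_prod)
    fix T assume T: "T \<subseteq> {1..n} - {k}" "card ({1..n} - {k}) < card T + card ?D"
    have "card T \<le> n - 1"
      using card_mono[OF _ T(1)] k by (simp add: card_Diff_singleton)
    \<comment> \<open>Otherwise every \<open>d\<close> in \<open>?D\<close> would exceed
      \<open>card T\<close>, leaving at most \<open>n - 1 - card T\<close> of them, against the size
      assumption on \<open>T\<close>.\<close>
    have "q < (\<Sum>j=1..card T. degree (g j))"
    proof (rule ccontr)
      assume *: "\<not> q < (\<Sum>j=1..card T. degree (g j))"
      have "?D \<subseteq> {card T + 1..<n}"
      proof
        fix d assume d: "d \<in> ?D"
        have "\<not> d \<le> card T"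
        proof
          assume "d \<le> card T"
          then have "(\<Sum>j=1..d. degree (g j)) \<le> (\<Sum>j=1..card T. degree (g j))"
            by (intro sum_mono2) auto
          then show False
            using * d by simp
        qed
        then show "d \<in> {card T + 1..<n}"
          using d by simp
      qed
      from card_mono[OF _ this] have "card ?D \<le> n - (card T + 1)"
        by simp
      then show False
        using T(2) k \<open>card T \<le> n - 1\<close> by (simp add: card_Diff_singleton)
    qed
    also have "\<dots> \<le> (\<Sum>j\<in>T. degree (g j))"
      using T(1) by (intro sum_initial_segment_le[OF mono]) auto
    finally show "q - p < (\<Sum>j\<in>T. degree (g j))"
      by simp
  qed (use cong in auto)
  then show ?thesis
    using assms(4) by (simp add: sylv_index[OF assms(3,4) kp] sylv_row_def)
qed

section \<open>Combinations of the cofactors\<close>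

lemma sylv_size_ge_degree:
  assumes "k \<in> {1..n}"
  shows "degree (g k) \<le> sylv_size n g"
  unfolding sylv_size_def using assms by (intro member_le_sum) auto

lemma degree_sylv_combination_less:
  assumes "1 \<le> n" and deg: "\<forall>k\<in>{1..n}. degree (u k) < degree (g k)"
  shows "degree (\<Sum>k=1..n. u k * sylv_cofactor n g k) < sylv_size n g"
proof (rule degree_sum_less)
  fix k assume k: "k \<in> {1..n}"
  have "degree (u k * sylv_cofactor n g k) \<le> degree (u k) + degree (sylv_cofactor n g k)"
    by (rule degree_mult_le)
  also have "\<dots> < degree (g k) + (sylv_size n g - degree (g k))"
    using deg k degree_sylv_cofactor_le[OF k, of g] by (intro add_less_le_mono) auto
  also have "\<dots> = sylv_size n g"
    using sylv_size_ge_degree[OF k, of g] by simp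
  finally show "degree (u k * sylv_cofactor n g k) < sylv_size n g" .
next
  have "degree (u 1) < degree (g 1)" "degree (g 1) \<le> sylv_size n g"
    using assms sylv_size_ge_degree[of 1 n g] by auto
  then show "0 < sylv_size n g"
    by linarith
qed

text \<open>A nonzero resultant makes the transposed Sylvester matrix injective.\<close>

lemma sylv_combination_eq_0D:
  fixes g :: "nat \<Rightarrow> 'a::idom poly"
  assumes "res n g \<noteq> 0" and deg: "\<forall>k\<in>{1..n}. degree (u k) < degree (g k)"
    and "(\<Sum>k=1..n. u k * sylv_cofactor n g k) = 0" and k: "k \<in> {1..n}"
  shows "u k = 0"
proof (rule sylv_vec_eq_0D[OF _ k])
  show "degree (u k) < degree (g k)"
    using deg k by blast
  have "transpose_mat (sylv n g) *\<^sub>v sylv_vec n g u = 0\<^sub>v (sylv_size n g)"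
  proof (rule eq_vecI)
    fix q assume "q < dim_vec (0\<^sub>v (sylv_size n g) :: 'a vec)"
    then show "(transpose_mat (sylv n g) *\<^sub>v sylv_vec n g u) $ q = 0\<^sub>v (sylv_size n g) $ q"
      using deg assms(3) by (subst transpose_sylv_mult_vec) auto
  qed (use sylv_carrier[of n g] in simp)
  moreover have "det (sylv n g) \<noteq> 0"
    using assms(1) by (simp add: res_def)
  ultimately show "sylv_vec n g u = 0\<^sub>v (sylv_size n g)"
    using transpose_mult_vec_eq_0[OF sylv_carrier _ sylv_vec_carrier] by blast
qed

text \<open>All columns together give \<open>e + (n - 1)\<close> factors \<open>\<pi>\<close>, and a
  single column has at most \<open>n - 1\<close> of them, so \<open>e\<close> remain in every entry
  of the adjugate. Of the \<open>t\<close> factors in the determinant, Cramer's rule then leaves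
  only \<open>t - e\<close> on the right-hand side.\<close>

lemma sylv_combination_solvable:
  fixes \<pi> :: "'a::idom"
  assumes "prime_elem \<pi>" and "1 \<le> n"
    and pos: "\<forall>k\<in>{1..n}. 0 < degree (g k)"
    and mono: "mono_on {1..n} (\<lambda>j. degree (g j))"
    and cong: "\<And>j. j \<in> {1..n} \<Longrightarrow> [:\<pi>:] dvd g j - monom 1 (degree (g j))"
    and res: "res n g = \<pi> ^ t * w" and "w dvd 1"
    and e: "e + (n - 1) = (\<Sum>d=1..<n. \<Sum>j=1..d. degree (g j))"
  shows "e \<le> t"
    and "degree b < sylv_size n g \<Longrightarrow>
         \<exists>u. (\<forall>k\<in>{1..n}. degree (u k) < degree (g k)) \<and>
             (\<Sum>k=1..n. u k * sylv_cofactor n g k) = [:\<pi> ^ (t - e):] * b"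
proof -
  define c where "c q = card {d \<in> {1..<n}. q < (\<Sum>j=1..d. degree (g j))}" for q
  have "\<pi> \<noteq> 0" "\<not> \<pi> dvd 1"
    using assms(1) by (auto simp: prime_elem_def)
  have dvd: "\<pi> ^ c q dvd sylv n g $$ (i, q)" if "i < sylv_size n g" "q < sylv_size n g" for i q
    unfolding c_def by (rule power_dvd_sylv_index[OF mono cong that])
  have sum_c: "(\<Sum>q<sylv_size n g. c q) = e + (n - 1)"
    unfolding c_def sylv_size_def e by (rule sum_card_partial_sums)
  have "\<pi> ^ (e + (n - 1)) dvd \<pi> ^ t * w"
    using prod_power_dvd_det[OF sylv_carrier dvd] by (simp only: sum_c flip: res res_def)
  \<comment> \<open>As \<open>w\<close> is a unit, no power beyond \<open>t\<close> divides the
    resultant, which bounds the column exponent by \<open>t\<close>.\<close>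
  moreover have "\<not> \<pi> ^ Suc t dvd \<pi> ^ t * w"
  proof
    assume "\<pi> ^ Suc t dvd \<pi> ^ t * w"
    then have "\<pi> ^ t * \<pi> dvd \<pi> ^ t * w"
      by (simp only: power_Suc2)
    then have "\<pi> dvd w"
      using \<open>\<pi> \<noteq> 0\<close> by (simp only: dvd_mult_cancel_left power_eq_0_iff) simp
    then show False
      using \<open>w dvd 1\<close> \<open>\<not> \<pi> dvd 1\<close> dvd_trans by blast
  qed
  ultimately have "e + (n - 1) \<le> t"
    using power_le_dvd not_less_eq_eq by blast
  then show "e \<le> t"
    by simp
  have c_le: "e + c q \<le> (\<Sum>q<sylv_size n g. c q)" for q
  proof -
    have "c q \<le> card {1..<n}"
      unfolding c_def by (intro card_mono) auto
    then show ?thesis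
      by (simp add: sum_c)
  qed
  assume b: "degree b < sylv_size n g"
  define bv where "bv = vec (sylv_size n g) (coeff b)"
  have "det (sylv n g) = \<pi> ^ (e + (t - e)) * w"
    using res \<open>e \<le> t\<close> by (simp add: res_def)
  from transpose_mult_vec_solvable[OF sylv_carrier \<open>\<pi> \<noteq> 0\<close> dvd c_le this \<open>w dvd 1\<close>, of bv]
  obtain y where y: "y \<in> carrier_vec (sylv_size n g)"
      and Ay: "transpose_mat (sylv n g) *\<^sub>v y = \<pi> ^ (t - e) \<cdot>\<^sub>v bv"
    by (auto simp: bv_def)
  obtain u where u: "y = sylv_vec n g u" and deg: "\<forall>k\<in>{1..n}. degree (u k) < degree (g k)"
    using sylv_vec_surj[OF y] pos by metis
  have "(\<Sum>k=1..n. u k * sylv_cofactor n g k) = [:\<pi> ^ (t - e):] * b"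
  proof (rule poly_eqI)
    fix q
    show "coeff (\<Sum>k=1..n. u k * sylv_cofactor n g k) q = coeff ([:\<pi> ^ (t - e):] * b) q"
    proof (cases "q < sylv_size n g")
      case True
      have "coeff (\<Sum>k=1..n. u k * sylv_cofactor n g k) q = (\<pi> ^ (t - e) \<cdot>\<^sub>v bv) $ q"
        unfolding Ay[symmetric] u using deg by (intro transpose_sylv_mult_vec[symmetric] True) auto
      also have "\<dots> = coeff ([:\<pi> ^ (t - e):] * b) q"
        using True by (simp add: bv_def)
      finally show ?thesis .
    next
      case False
      have "degree (\<Sum>k=1..n. u k * sylv_cofactor n g k) < q"
        using degree_sylv_combination_less[OF \<open>1 \<le> n\<close> deg] False by linarith
      moreover have "degree b < q"
        using b False by linarith
      ultimately show ?thesis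
        by (simp add: coeff_eq_0)
    qed
  qed
  then show "\<exists>u. (\<forall>k\<in>{1..n}. degree (u k) < degree (g k)) \<and>
      (\<Sum>k=1..n. u k * sylv_cofactor n g k) = [:\<pi> ^ (t - e):] * b"
    using deg by blast
qed

section \<open>Lifting factorizations\<close>

lemma dvd_mult_diff:
  fixes d :: "'a::comm_ring_1"
  assumes "d dvd x - x'" and "d dvd y - y'"
  shows "d dvd x * y - x' * y'"
proof -
  have "x * y - x' * y' = (x - x') * y + x' * (y - y')"
    by (simp add: algebra_simps)
  then show ?thesis
    using assms by simp
qed

text \<open>All terms with at least two of the \<open>u k\<close> contain \<open>c\<^sup>2\<close>.
  The remainder \<open>Q\<close> is a polynomial expression in the \<open>u k\<close> and so
  respects congruences.\<close>

lemma prod_add_mult_expansion: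
  fixes g :: "'b \<Rightarrow> 'a::comm_ring_1"
  assumes "finite S"
  shows "\<exists>Q. (\<forall>u. (\<Prod>k\<in>S. g k + c * u k) =
                 prod g S + c * (\<Sum>k\<in>S. u k * prod g (S - {k})) + c\<^sup>2 * Q u) \<and>
             (\<forall>d u v. (\<forall>k\<in>S. d dvd u k - v k) \<longrightarrow> d dvd Q u - Q v)"
  using assms
proof (induction S rule: finite_induct)
  case empty
  show ?case
    by (intro exI[of _ "\<lambda>_. 0"]) simp
next
  case (insert k S)
  define L where "L u = (\<Sum>j\<in>S. u j * prod g (S - {j}))" for u
  obtain Q where Q: "\<And>u. (\<Prod>k\<in>S. g k + c * u k) = prod g S + c * L u + c\<^sup>2 * Q u"
      and cong: "\<And>d u v. \<forall>k\<in>S. d dvd u k - v k \<Longrightarrow> d dvd Q u - Q v"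
    using insert.IH unfolding L_def by blast
  have L: "(\<Sum>j\<in>insert k S. u j * prod g (insert k S - {j})) = u k * prod g S + g k * L u" for u
  proof -
    have "prod g (insert k S - {j}) = g k * prod g (S - {j})" if "j \<in> S" for j
    proof -
      have "insert k S - {j} = insert k (S - {j})"
        using insert.hyps that by auto
      then show ?thesis
        using insert.hyps by simp
    qed
    moreover have "insert k S - {k} = S"
      using insert.hyps by simp
    ultimately show ?thesis
      using insert.hyps by (simp add: L_def sum_distrib_left mult.left_commute)
  qed
  define Q' where "Q' u = g k * Q u + u k * L u + c * (u k * Q u)" for u
  have "(\<Prod>j\<in>insert k S. g j + c * u j) =
      prod g (insert k S) + c * (u k * prod g S + g k * L u) + c\<^sup>2 * Q' u" for u
    using insert.hyps by (simp add: Q Q'_def algebra_simps power2_eq_square)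
  moreover have "d dvd Q' u - Q' v" if d: "\<forall>j\<in>insert k S. d dvd u j - v j" for d u v
  proof -
    have Qd: "d dvd Q u - Q v"
      using d by (intro cong) simp
    have "L u - L v = (\<Sum>j\<in>S. (u j - v j) * prod g (S - {j}))"
      by (simp add: L_def sum_subtractf left_diff_distrib)
    then have "d dvd L u - L v"
      using d by (auto intro!: dvd_sum)
    then have "d dvd u k * L u - v k * L v" "d dvd u k * Q u - v k * Q v"
      using d Qd by (auto intro: dvd_mult_diff)
    moreover have "Q' u - Q' v = g k * (Q u - Q v) + (u k * L u - v k * L v)
        + c * (u k * Q u - v k * Q v)"
      by (simp add: Q'_def algebra_simps)
    ultimately show ?thesis
      using Qd by simp
  qed
  ultimately show ?case
    unfolding L by blast
qed

text \<open>Here \<open>t\<close> is the loss in inverting the linear part, which the theorem calls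
  \<open>t'\<close>, and not the valuation of the resultant.\<close>

lemma hensel_factorization:
  fixes \<pi> :: "'a::complete_discrete_valuation_ring"
  assumes unif: "uniformizer \<pi>" and "1 \<le> n"
    and f: "lead_coeff f = 1"
    and g: "\<forall>k\<in>{1..n}. lead_coeff (g k) = 1 \<and> 0 < degree (g k)"
    and res: "res n g \<noteq> 0"
    and solvable: "\<And>b. degree b < sylv_size n g \<Longrightarrow>
         \<exists>u. (\<forall>k\<in>{1..n}. degree (u k) < degree (g k)) \<and>
             (\<Sum>k=1..n. u k * sylv_cofactor n g k) = [:\<pi> ^ t:] * b"
    and s: "2 * t < s" and cong: "[:\<pi> ^ s:] dvd f - (\<Prod>k\<in>{1..n}. g k)"
  shows "\<exists>!h. h \<in> {1..n} \<rightarrow>\<^sub>E {p. lead_coeff p = 1} \<and>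
              (\<forall>k\<in>{1..n}. [:\<pi> ^ (s - t):] dvd h k - g k) \<and> f = (\<Prod>k\<in>{1..n}. h k)"
proof -
  define N where "N = sylv_size n g"
  define P where "P = (\<Prod>k\<in>{1..n}. g k)"
  define L where "L u = (\<Sum>k=1..n. u k * sylv_cofactor n g k)" for u
  define V where "V u \<longleftrightarrow> (\<forall>k\<in>{1..n}. degree (u k) < degree (g k))" for u :: "nat \<Rightarrow> 'a poly"
  \<comment> \<open>\<open>a\<close> scales the perturbation and \<open>d\<close> is the loss, with
    \<open>a * d\<close> the modulus \<open>\<pi> ^ s\<close>. The surplus \<open>r\<close> of
    \<open>a\<^sup>2\<close> over this modulus is divisible by \<open>\<pi>\<close> because
    \<open>2 * t < s\<close>.\<close>
  define a where "a = [:\<pi> ^ (s - t):]"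
  define d where "d = [:\<pi> ^ t:]"
  define r where "r = [:\<pi> ^ (s - 2 * t):]"
  have "\<pi> \<noteq> 0" "\<not> \<pi> dvd 1"
    using uniformizer_imp_prime_elem[OF unif] by (auto simp: prime_elem_def)
  have nonunit: "\<not> \<pi> ^ i dvd 1" if "0 < i" for i
    using \<open>\<not> \<pi> dvd 1\<close> that dvd_power dvd_trans by metis
  have nonzero: "a \<noteq> 0" "d \<noteq> 0"
    using \<open>\<pi> \<noteq> 0\<close> by (auto simp: a_def d_def)
  have "[:\<pi> ^ (s - t + t):] = a * d"
    by (simp add: a_def d_def power_add)
  then have ad: "[:\<pi> ^ s:] = a * d"
    using s by simp
  have "a\<^sup>2 = [:\<pi> ^ (s - t + (s - t)):]"
    by (simp add: a_def power2_eq_square power_add)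
  also have "s - t + (s - t) = s + (s - 2 * t)"
    using s by simp
  also have "[:\<pi> ^ (s + (s - 2 * t)):] = a * d * r"
    by (simp add: r_def power_add flip: ad)
  finally have aa: "a\<^sup>2 = a * d * r" .
  have "0 < N"
  proof -
    have "0 < degree (g 1)"
      using g \<open>1 \<le> n\<close> by simp
    also have "\<dots> \<le> N"
      unfolding N_def using \<open>1 \<le> n\<close> by (intro sylv_size_ge_degree) simp
    finally show ?thesis .
  qed
  have P: "lead_coeff P = 1" "degree P = N"
    unfolding P_def N_def sylv_size_def
    using g by (intro lead_coeff_prod_monic degree_prod_monic; blast)+
  have deg_f: "degree f = N"
    using monic_cong_degree_eq[OF f P(1) cong[folded P_def] nonunit] s P(2) by simp
  obtain b where b: "f - P = a * d * b"
    using cong unfolding P_def ad by (elim dvdE)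

  \<comment> \<open>Expansion of the perturbed product\<close>
  obtain Q where Q: "\<And>u. (\<Prod>k\<in>{1..n}. g k + a * u k) = P + a * L u + a\<^sup>2 * Q u"
      and Q_cong: "\<And>c u v. \<forall>k\<in>{1..n}. c dvd u k - v k \<Longrightarrow> c dvd Q u - Q v"
    using prod_add_mult_expansion[of "{1..n}" g a]
    unfolding P_def L_def sylv_cofactor_def by auto
  \<comment> \<open>Cancelling \<open>a\<close> leaves \<open>L u = d * (b - r * Q u)\<close>, whose
    right-hand side is a multiple of \<open>d\<close>, as the inversion of \<open>L\<close>
    demands.\<close>
  have eq: "f - (\<Prod>k\<in>{1..n}. g k + a * u k) = a * (d * (b - r * Q u) - L u)" for u
  proof -
    have "f - (\<Prod>k\<in>{1..n}. g k + a * u k) = (f - P) - a * L u - a\<^sup>2 * Q u"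
      unfolding Q by simp
    also have "\<dots> = a * (d * (b - r * Q u) - L u)"
      unfolding b aa by (simp add: algebra_simps)
    finally show ?thesis .
  qed
  have monic: "lead_coeff (g k + a * u k) = 1" "degree (g k + a * u k) = degree (g k)"
    if "V u" "k \<in> {1..n}" for u k
  proof -
    have less: "degree (a * u k) < degree (g k)"
      using that nonzero(1) by (auto simp: V_def a_def)
    show deg: "degree (g k + a * u k) = degree (g k)"
      by (rule degree_add_eq_left[OF less])
    show "lead_coeff (g k + a * u k) = 1"
      unfolding deg using g that(2) coeff_eq_0[OF less] by simp
  qed
  have deg_L: "degree (L u) < N" if "V u" for u
    using that degree_sylv_combination_less[OF \<open>1 \<le> n\<close>] by (simp add: V_def L_def N_def)
  \<comment> \<open>\<open>Q\<close> comes without a degree bound. The bound is read off from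
    \<open>eq\<close>, whose left-hand side is a difference of two monic polynomials of degree
    \<open>N\<close>.\<close>
  have deg_arg: "degree (b - r * Q u) < N" if "V u" for u
  proof -
    have "degree (f - (\<Prod>k\<in>{1..n}. g k + a * u k)) < N"
    proof (rule degree_diff_monic_less[OF f _ deg_f _ \<open>0 < N\<close>])
      show "lead_coeff (\<Prod>k\<in>{1..n}. g k + a * u k) = 1"
        using monic[OF that] by (intro lead_coeff_prod_monic)
      have "degree (\<Prod>k\<in>{1..n}. g k + a * u k) = (\<Sum>k\<in>{1..n}. degree (g k + a * u k))"
        using monic[OF that] by (intro degree_prod_monic)
      also have "\<dots> = N"
        unfolding N_def sylv_size_def using monic[OF that] by (intro sum.cong) auto
      finally show "degree (\<Prod>k\<in>{1..n}. g k + a * u k) = N" .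
    qed
    then have "degree (d * (b - r * Q u) - L u) < N"
      unfolding eq using \<open>\<pi> \<noteq> 0\<close> by (simp add: a_def)
    from degree_add_less[OF this deg_L[OF that]] have "degree (d * (b - r * Q u)) < N"
      by simp
    then show ?thesis
      using \<open>\<pi> \<noteq> 0\<close> by (simp add: d_def)
  qed

  \<comment> \<open>The choice is harmless: by \<open>L_inj\<close> the solution is determined on
    \<open>{1..n}\<close>.\<close>
  define T where "T w = (SOME u. V u \<and> L u = d * w)" for w
  have T: "V (T w)" "L (T w) = d * w" if "degree w < N" for w
  proof -
    have "\<exists>u. V u \<and> L u = d * w"
      using solvable[of w] that by (simp only: V_def L_def N_def d_def)
    then have "V (T w) \<and> L (T w) = d * w"
      unfolding T_def by (rule someI_ex)
    then show "V (T w)" "L (T w) = d * w"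
      by simp_all
  qed
  have L_inj: "u k = v k" if "V u" "V v" "L u = L v" "k \<in> {1..n}" for u v k
  proof -
    have "(\<Sum>k=1..n. (u k - v k) * sylv_cofactor n g k) = 0"
      using that(3) by (simp add: L_def left_diff_distrib sum_subtractf)
    then have "u k - v k = 0"
      using that by (intro sylv_combination_eq_0D[OF res, of "\<lambda>k. u k - v k"])
        (auto simp: V_def intro: degree_diff_less)
    then show ?thesis
      by simp
  qed
  have L_linear: "L (\<lambda>k. u k + c * v k) = L u + c * L v" for u v c
    by (simp add: L_def distrib_right sum.distrib sum_distrib_left mult.assoc)
  \<comment> \<open>By linearity, \<open>T w' + c * T z\<close> solves the same equation as
    \<open>T w\<close>, so injectivity identifies them on \<open>{1..n}\<close>.\<close>
  have T_cong: "[:c:] dvd T w k - T w' k"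
    if w: "degree w < N" "degree w' < N" "[:c:] dvd w - w'" and "c \<noteq> 0" and k: "k \<in> {1..n}" for c w w' k
  proof -
    obtain z where z: "w - w' = [:c:] * z"
      using w(3) by (elim dvdE)
    have "degree (w - w') < N"
      using w(1,2) by (rule degree_diff_less)
    then have "degree z < N"
      unfolding z using \<open>c \<noteq> 0\<close> by simp
    have "L (\<lambda>k. T w' k + [:c:] * T z k) = L (T w') + [:c:] * L (T z)"
      by (rule L_linear)
    also have "\<dots> = d * (w' + [:c:] * z)"
      unfolding T(2)[OF w(2)] T(2)[OF \<open>degree z < N\<close>]
      by (simp only: distrib_left mult.left_commute)
    also have "\<dots> = L (T w)"
      unfolding T(2)[OF w(1)] z[symmetric] by simp
    finally have L_eq: "L (\<lambda>k. T w' k + [:c:] * T z k) = L (T w)" .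
    have "V (\<lambda>k. T w' k + [:c:] * T z k)"
      using T(1)[OF w(2)] T(1)[OF \<open>degree z < N\<close>] \<open>c \<noteq> 0\<close>
      by (simp add: V_def degree_add_less)
    from L_inj[OF this T(1)[OF w(1)] L_eq k] have "T w k = T w' k + [:c:] * T z k"
      by (rule sym)
    then have "T w k - T w' k = [:c:] * T z k"
      by simp
    then show ?thesis
      by (rule dvdI)
  qed

  \<comment> \<open>The contraction and its fixed points\<close>
  define \<Phi> where "\<Phi> u = T (b - r * Q u)" for u
  have \<Phi>_V: "V (\<Phi> u)" if "V u" for u
    unfolding \<Phi>_def by (intro T(1) deg_arg that)
  have contr: "\<forall>k\<in>{1..n}. [:\<pi> ^ Suc i:] dvd \<Phi> u k - \<Phi> v k"
    if "V u" "V v" "\<forall>k\<in>{1..n}. [:\<pi> ^ i:] dvd u k - v k" for i u v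
  proof
    fix k assume k: "k \<in> {1..n}"
    have "[:\<pi> ^ i:] dvd Q v - Q u"
      using Q_cong[OF that(3)] by (subst minus_diff_eq[symmetric]) (simp only: dvd_minus_iff)
    \<comment> \<open>This is the factor \<open>\<pi>\<close> gained by the contraction.\<close>
    moreover have "[:\<pi>:] dvd r"
      unfolding r_def const_poly_dvd_const_poly_iff using s by (intro dvd_power) simp
    ultimately have "[:\<pi>:] * [:\<pi> ^ i:] dvd r * (Q v - Q u)"
      by (intro mult_dvd_mono)
    then have dvd: "[:\<pi> ^ Suc i:] dvd (b - r * Q u) - (b - r * Q v)"
      by (simp add: right_diff_distrib mult.commute)
    have "\<pi> ^ Suc i \<noteq> 0"
      using \<open>\<pi> \<noteq> 0\<close> by simp
    from T_cong[OF deg_arg[OF that(1)] deg_arg[OF that(2)] dvd this k]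
    show "[:\<pi> ^ Suc i:] dvd \<Phi> u k - \<Phi> v k"
      by (simp only: \<Phi>_def)
  qed
  have fixed_iff: "f = (\<Prod>k\<in>{1..n}. g k + a * u k) \<longleftrightarrow> (\<forall>k\<in>{1..n}. \<Phi> u k = u k)" if "V u" for u
  proof -
    have "f = (\<Prod>k\<in>{1..n}. g k + a * u k) \<longleftrightarrow> a * (d * (b - r * Q u) - L u) = 0"
      unfolding eq[symmetric] by simp
    also have "\<dots> \<longleftrightarrow> L (\<Phi> u) = L u"
      using nonzero(1) by (simp add: \<Phi>_def T(2)[OF deg_arg[OF that]])
    also have "\<dots> \<longleftrightarrow> (\<forall>k\<in>{1..n}. \<Phi> u k = u k)"
    proof
      assume "L (\<Phi> u) = L u"
      then show "\<forall>k\<in>{1..n}. \<Phi> u k = u k"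
        using L_inj[OF \<Phi>_V[OF that] that] by blast
    next
      assume "\<forall>k\<in>{1..n}. \<Phi> u k = u k"
      then show "L (\<Phi> u) = L u"
        by (simp only: L_def cong: sum.cong)
    qed
    finally show ?thesis .
  qed

  \<comment> \<open>Existence and uniqueness of the factors\<close>
  have "\<exists>u. (\<forall>k\<in>{1..n}. degree (u k) < degree (g k)) \<and> (\<forall>k\<in>{1..n}. \<Phi> u k = u k)"
  proof (rule adic_contraction_fixed_point[OF unif])
    show "0 < degree (g k)" if "k \<in> {1..n}" for k
      using g that by blast
    show "\<forall>k\<in>{1..n}. degree (\<Phi> u k) < degree (g k)"
      if "\<forall>k\<in>{1..n}. degree (u k) < degree (g k)" for u
      using \<Phi>_V[unfolded V_def, OF that] .
    fix i u v
    assume "\<forall>k\<in>{1..n}. degree (u k) < degree (g k)" "\<forall>k\<in>{1..n}. degree (v k) < degree (g k)"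
      "\<forall>k\<in>{1..n}. [:\<pi> ^ i:] dvd u k - v k"
    then show "\<forall>k\<in>{1..n}. [:\<pi> ^ Suc i:] dvd \<Phi> u k - \<Phi> v k"
      by (rule contr[unfolded V_def])
  qed
  then obtain u where u: "V u" "\<forall>k\<in>{1..n}. \<Phi> u k = u k"
    by (auto simp only: V_def)
  show ?thesis
  \<comment> \<open>The restriction fixes the values outside \<open>{1..n}\<close> as
    \<open>undefined\<close>, so that uniqueness is equality of functions.\<close>
  proof (rule ex1I[of _ "\<lambda>k\<in>{1..n}. g k + a * u k"])
    show "(\<lambda>k\<in>{1..n}. g k + a * u k) \<in> {1..n} \<rightarrow>\<^sub>E {p. lead_coeff p = 1} \<and>
        (\<forall>k\<in>{1..n}. [:\<pi> ^ (s - t):] dvd (\<lambda>k\<in>{1..n}. g k + a * u k) k - g k) \<and>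
        f = (\<Prod>k\<in>{1..n}. (\<lambda>k\<in>{1..n}. g k + a * u k) k)"
    proof (intro conjI)
      show "(\<lambda>k\<in>{1..n}. g k + a * u k) \<in> {1..n} \<rightarrow>\<^sub>E {p. lead_coeff p = 1}"
        by (intro restrict_PiE_iff[THEN iffD2] ballI CollectI monic(1) u(1))
      show "\<forall>k\<in>{1..n}. [:\<pi> ^ (s - t):] dvd (\<lambda>k\<in>{1..n}. g k + a * u k) k - g k"
        by (simp flip: a_def)
      show "f = (\<Prod>k\<in>{1..n}. (\<lambda>k\<in>{1..n}. g k + a * u k) k)"
        using fixed_iff[OF u(1)] u(2) by simp
    qed
  next
    fix h assume h: "h \<in> {1..n} \<rightarrow>\<^sub>E {p. lead_coeff p = 1} \<and>
        (\<forall>k\<in>{1..n}. [:\<pi> ^ (s - t):] dvd h k - g k) \<and> f = (\<Prod>k\<in>{1..n}. h k)"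
    have "\<forall>k\<in>{1..n}. \<exists>v. h k = g k + a * v"
    proof
      fix k assume "k \<in> {1..n}"
      then have "a dvd h k - g k"
        using h by (simp only: a_def)
      then obtain v where "h k - g k = a * v" ..
      then have "h k = g k + a * v"
        by (simp add: algebra_simps)
      then show "\<exists>v. h k = g k + a * v" ..
    qed
    then obtain v where v: "\<And>k. k \<in> {1..n} \<Longrightarrow> h k = g k + a * v k"
      by metis
    \<comment> \<open>Congruent monic polynomials have equal degree because \<open>a\<close> is not
      a unit; in \<open>h k - g k\<close> the leading terms cancel, which bounds the degree of
      \<open>v k\<close>.\<close>
    have "V v"
      unfolding V_def
    proof
      fix k assume k: "k \<in> {1..n}"
      then have lc: "lead_coeff (h k) = 1" "lead_coeff (g k) = 1"
        using h g by auto
      have "degree (h k) = degree (g k)"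
        using h k s by (intro monic_cong_degree_eq[OF lc _ nonunit]) auto
      then have "degree (h k - g k) < degree (g k)"
        using lc g k by (intro degree_diff_monic_less) auto
      then show "degree (v k) < degree (g k)"
        using \<open>\<pi> \<noteq> 0\<close> by (simp add: v[OF k] a_def)
    qed
    moreover have "f = (\<Prod>k\<in>{1..n}. g k + a * v k)"
      using h v by simp
    ultimately have v_fixed: "\<forall>k\<in>{1..n}. \<Phi> v k = v k"
      using fixed_iff by blast
    have "v k = u k" if "k \<in> {1..n}" for k
      by (rule adic_contraction_unique[OF unif contr[OF \<open>V v\<close> u(1)] v_fixed u(2) that])
    then have "restrict h {1..n} = (\<lambda>k\<in>{1..n}. g k + a * u k)"
      by (intro restrict_ext) (simp add: v)
    then show "h = (\<lambda>k\<in>{1..n}. g k + a * u k)"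
      using PiE_restrict[of h "{1..n}" "\<lambda>_. {p. lead_coeff p = 1}"] h by (simp only:)
  qed
qed

theorem theorem22:
  fixes \<pi> :: "'a::complete_discrete_valuation_ring"
    and f :: "'a poly" and g :: "nat \<Rightarrow> 'a poly"
    and M n s t :: nat and t' :: int
  assumes "uniformizer \<pi>"
    and "lead_coeff f = 1" and "degree f = M"
    and "poly_cong \<pi> f (monom 1 M)"
    and "1 \<le> n"
    and "\<forall>k\<in>{1..n}. lead_coeff (g k) = 1 \<and> 1 \<le> degree (g k)"
    and "\<forall>j\<in>{1..n}. \<forall>k\<in>{1..n}. j \<le> k \<longrightarrow> degree (g j) \<le> degree (g k)"
    and "res n g \<noteq> 0"
    and "valuation \<pi> (res n g) = enat t"
    and "t' = int t - (\<Sum>j\<in>{1..n-1}. ((int n - int j) * int (degree (g j)) - 1))"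
    and "1 \<le> s" and "int s \<ge> int t + t' + 1"
    and "poly_cong (\<pi> ^ s) f (\<Prod>k\<in>{1..n}. g k)"
  shows "\<exists>!h. h \<in> {1..n} \<rightarrow>\<^sub>E {p. lead_coeff p = 1} \<and>
              (\<forall>k\<in>{1..n}. poly_cong (\<pi> ^ nat (int s - t')) (h k) (g k)) \<and>
              f = (\<Prod>k\<in>{1..n}. h k)"
proof -

  \<comment> \<open>Reduction of the theorem to the lifting lemma\<close>
  have prime: "prime_elem \<pi>"
    by (rule uniformizer_imp_prime_elem[OF assms(1)])
  obtain w where w: "res n g = \<pi> ^ t * w" "w dvd 1"
    using valuation_eq_enatE[OF assms(1,9)] .
  have monic: "lead_coeff (g k) = 1" "0 < degree (g k)" if "k \<in> {1..n}" for k
    using assms(6) that by fastforce+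
  have cong_s: "[:\<pi> ^ s:] dvd f - (\<Prod>k\<in>{1..n}. g k)"
    using assms(13) by (simp add: poly_cong_def)
  have "[:\<pi>:] dvd [:\<pi> ^ s:]"
    using assms(11) by (simp add: const_poly_dvd_const_poly_iff dvd_power)
  then have "[:\<pi>:] dvd f - (\<Prod>k\<in>{1..n}. g k)"
    using cong_s by (rule dvd_trans)
  moreover have "[:\<pi>:] dvd f - monom 1 M"
    using assms(4) by (simp add: poly_cong_def)
  ultimately have "[:\<pi>:] dvd (f - monom 1 M) - (f - (\<Prod>k\<in>{1..n}. g k))"
    by (rule dvd_diff[rotated])
  then have prod_cong: "[:\<pi>:] dvd (\<Prod>k\<in>{1..n}. g k) - monom 1 M"
    by simp
  have "\<not> \<pi> dvd 1"
    using prime by (simp add: prime_elem_def)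
  have M: "M = degree (\<Prod>k\<in>{1..n}. g k)"
    using monic_cong_degree_eq[OF lead_coeff_prod_monic _ prod_cong \<open>\<not> \<pi> dvd 1\<close>] monic(1)
    by (simp add: degree_monom_eq)
  \<comment> \<open>The product of the \<open>g k\<close> is congruent to \<open>X ^ M\<close>, and
    its monic factors inherit this shape.\<close>
  have cong: "[:\<pi>:] dvd g k - monom 1 (degree (g k))" if k: "k \<in> {1..n}" for k
  proof (rule monic_factor_cong_monom[OF prime])
    have prod: "(\<Prod>k\<in>{1..n}. g k) = g k * sylv_cofactor n g k"
      using k by (simp add: sylv_cofactor_def prod.remove)
    show cof: "lead_coeff (sylv_cofactor n g k) = 1"
      unfolding sylv_cofactor_def using monic by (intro lead_coeff_prod_monic) auto
    have Mk: "M = degree (g k) + degree (sylv_cofactor n g k)"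
      unfolding M prod using monic[OF k] cof by (intro degree_mult_eq) auto
    then show "[:\<pi>:] dvd g k * sylv_cofactor n g k -
        monom 1 (degree (g k) + degree (sylv_cofactor n g k))"
      using prod_cong by (simp only: prod flip: Mk)
  qed (use monic k in auto)
  \<comment> \<open>This is the total exponent of the columns. Each of its \<open>n - 1\<close>
    partial sums is at least \<open>1\<close>, so the subtraction in \<open>e\<close> below is
    exact.\<close>
  define m where "m = (\<Sum>d=1..<n. \<Sum>j=1..d. degree (g j))"
  have "(\<Sum>d=1..<n. 1) \<le> m"
    unfolding m_def
  proof (rule sum_mono)
    fix d assume "d \<in> {1..<n}"
    then have "1 \<le> degree (g 1)" "degree (g 1) \<le> (\<Sum>j=1..d. degree (g j))"
      using monic(2)[of 1] by (auto intro!: member_le_sum)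
    then show "1 \<le> (\<Sum>j=1..d. degree (g j))"
      by (rule order_trans)
  qed
  then have "n - 1 \<le> m"
    by simp
  define e where "e = m - (n - 1)"
  have e: "e + (n - 1) = m"
    using \<open>n - 1 \<le> m\<close> by (simp add: e_def)
  have mono: "mono_on {1..n} (\<lambda>j. degree (g j))"
    using assms(7) by (intro mono_onI) blast
  have pos: "\<forall>k\<in>{1..n}. 0 < degree (g k)"
    using monic(2) by blast
  note combination = sylv_combination_solvable[OF prime assms(5) pos mono _ w e[unfolded m_def]]
  have "e \<le> t"
    by (rule combination(1)) (rule cong)
  \<comment> \<open>The integer \<open>t'\<close> is thus the natural number \<open>t - e\<close>,
    the loss in inverting the linear part.\<close>
  have "t' = int t - (int m - int (n - 1))"
    using assms(10) sum_partial_sums[OF assms(5), of "\<lambda>j. degree (g j)"] by (simp add: m_def)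
  then have t': "t' = int (t - e)"
    using e \<open>e \<le> t\<close> by linarith
  \<comment> \<open>From \<open>t' \<le> t\<close>, the bound \<open>s \<ge> t + t' + 1\<close>
    yields \<open>s > 2 * t'\<close>.\<close>
  have "2 * (t - e) < s"
    using assms(12) \<open>e \<le> t\<close> unfolding t' by linarith
  have "nat (int s - t') = s - (t - e)"
    unfolding t' by linarith
  then show ?thesis
    unfolding poly_cong_def
  proof (simp only:, intro hensel_factorization[OF assms(1,5,2) _ assms(8) _ \<open>2 * (t - e) < s\<close> cong_s])
    show "\<forall>k\<in>{1..n}. lead_coeff (g k) = 1 \<and> 0 < degree (g k)"
      using monic by blast
    show "\<exists>u. (\<forall>k\<in>{1..n}. degree (u k) < degree (g k)) \<and>
        (\<Sum>k=1..n. u k * sylv_cofactor n g k) = [:\<pi> ^ (t - e):] * b"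
      if "degree b < sylv_size n g" for b
      using that by (intro combination(2) cong)
  qed
qed

end
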